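(* Let $$P(z)=p_0+\sum_{m\in M}p_mz^m+\sum_{n\in N}q_n\bar z^n,\qquad z\in\mathbb D,$$ where $p_0\in\mathbb R$ with $p_0\ge1$, $M,N\subset\{1,2,3,\dots\}$ are finite sets, and $p_m,q_n\in\mathbb C$ are non-zero for all $m\in M$, $n\in N$, with $$\sum_{m\in M}|p_m|+\sum_{n\in N}|q_n|=1.$$ (i) If $p_0>1$, then the Toeplitz operator $T_P$ is invertible on $A^2$. (ii) If $p_0=1$, then $T_P$ is not invertible if and only if there exist $\lambda\in[0,2\pi]$ and, for all $m\in M$ and $n\in N$, integers $k_m$ and $\ell_n$ such that $$m\lambda+\arg p_m=\pi+2\pi k_m\quad\text{and}\quad -n\lambda+\arg q_n=\pi+2\pi\ell_n .$$
   Context: $\mathbb D$ is the open unit disc, $A^2$ the Bergman space of analytic functions in $L^2(\mathbb D,dA)$ with $dA$ normalized area measure, $P_B$ the orthogonal projection $L^2\to A^2$, and for bounded $\varphi$ the Toeplitz operator is $T_\varphi f=P_B(\varphi f)$ on $A^2$. $\arg z$ denotes an argument of the complex number $z$. *)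

theory Defs
  imports "HOL-Analysis.Analysis"
begin

abbreviation disc :: "complex set" where
  "disc \<equiv> ball 0 1"

text \<open>Inner product of L^2(D, dA), dA = normalized area measure (Lebesgue measure / pi).\<close>
definition L2_inner :: "(complex \<Rightarrow> complex) \<Rightarrow> (complex \<Rightarrow> complex) \<Rightarrow> complex" where
  "L2_inner g k = (LINT z : disc | lborel. g z * cnj (k z)) / complex_of_real pi"

definition L2_norm_disc :: "(complex \<Rightarrow> complex) \<Rightarrow> real" where
  "L2_norm_disc f = sqrt ((LINT z : disc | lborel. (cmod (f z))\<^sup>2) / pi)"

text \<open>Bergman space A^2: analytic functions on D that are square integrable on D.
  Functions are normalised to vanish outside D (so that an element is determined by its
  values on D).\<close>
definition Bergman :: "(complex \<Rightarrow> complex) set" where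
  "Bergman = {f. f holomorphic_on disc \<and> (\<forall>z. z \<notin> disc \<longrightarrow> f z = 0)
                 \<and> set_integrable lborel disc (\<lambda>z. (cmod (f z))\<^sup>2)}"

definition bergman_proj :: "(complex \<Rightarrow> complex) \<Rightarrow> (complex \<Rightarrow> complex)" where
  "bergman_proj g = (THE h. h \<in> Bergman \<and> (\<forall>k\<in>Bergman. L2_inner (\<lambda>z. g z - h z) k = 0))"

definition toeplitz :: "(complex \<Rightarrow> complex) \<Rightarrow> (complex \<Rightarrow> complex) \<Rightarrow> (complex \<Rightarrow> complex)" where
  "toeplitz \<phi> f = bergman_proj (\<lambda>z. \<phi> z * f z)"

definition invertible_on_Bergman :: "((complex \<Rightarrow> complex) \<Rightarrow> (complex \<Rightarrow> complex)) \<Rightarrow> bool" where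
  "invertible_on_Bergman T \<longleftrightarrow>
     (\<forall>f\<in>Bergman. T f \<in> Bergman) \<and>
     (\<exists>S. (\<forall>f\<in>Bergman. S f \<in> Bergman \<and> S (T f) = f \<and> T (S f) = f) \<and>
          (\<exists>C. \<forall>f\<in>Bergman. L2_norm_disc (S f) \<le> C * L2_norm_disc f))"

end

theory Submission
  imports Defs "HOL-Complex_Analysis.Complex_Analysis"
begin

text \<open>
  Write \<open>P = p0 + u\<close>. On the closed disc \<open>\<bar>u\<bar> \<le> 1\<close>, hence \<open>Re P \<ge> p0 - 1\<close>, and for \<open>p0 = 1\<close>
  equality \<open>Re P z = 0\<close> forces every summand of \<open>u z\<close> to equal minus its largest possible modulus;
  this happens only on the unit circle and is the condition on the arguments.
  If \<open>Re P\<close> is bounded below by a positive constant, then \<open>T\<^sub>P\<close> is invertible by a contraction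
  argument. If \<open>P\<close> vanishes at a point \<open>\<zeta>\<close> of the unit circle, then powers of a function peaking
  at \<open>\<zeta>\<close> show that \<open>T\<^sub>P\<close> is not bounded below.
  Completeness of the Bergman space, which gives both the projection and the fixed point, rests on
  the area mean value property of \<open>f\<^sup>2\<close>.
\<close>

section \<open>Square integrable functions\<close>

text \<open>\<open>bergman_proj\<close> is a definite description, so nothing can be said about
  \<open>toeplitz\<close> before the orthogonal projection is known to exist and to be unique.
  Members of \<open>L2_space\<close> are functions, not classes, and \<open>L2_sq\<close> is only
  the square of a seminorm there. On \<open>Bergman\<close> it separates functions, because they
  vanish outside the disc and their values inside are controlled by the norm.

  Invertibility includes a bounded inverse, and this shapes both directions. A positive lower bound
  for Re P has to yield surjectivity together with an estimate of f by its image; conversely,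
  violating that estimate refutes invertibility. Since the projection does not increase the norm, it
  is enough to make P f small relative to f, so the projection never has to be computed.

  For \<open>p0 = 1\<close> the required lower bound comes from compactness: Re P attains its
  minimum on the closed disc, and if the argument condition fails this minimum is positive.\<close>

definition L2_space :: "'a measure \<Rightarrow> ('a \<Rightarrow> complex) set" where
  "L2_space M = {g \<in> borel_measurable M. integrable M (\<lambda>x. (cmod (g x))\<^sup>2)}"

text \<open>The square is kept because the expansions below are polynomial in it. No factor 1/pi is
  included; it enters only in \<open>L2_inner_eq\<close> and \<open>L2_norm_disc_eq\<close>.\<close>

definition L2_sq :: "'a measure \<Rightarrow> ('a \<Rightarrow> complex) \<Rightarrow> real" where
  "L2_sq M g = (LINT x|M. (cmod (g x))\<^sup>2)"

definition L2_ip :: "'a measure \<Rightarrow> ('a \<Rightarrow> complex) \<Rightarrow> ('a \<Rightarrow> complex) \<Rightarrow> complex" where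
  "L2_ip M g k = (LINT x|M. g x * cnj (k x))"

lemma L2_spaceD:
  assumes "g \<in> L2_space M"
  shows "g \<in> borel_measurable M" "integrable M (\<lambda>x. (cmod (g x))\<^sup>2)"
  using assms by (auto simp: L2_space_def)

lemma L2_sq_nonneg [simp]: "L2_sq M g \<ge> 0"
  by (simp add: L2_sq_def)

lemma norm_add_sq_le: "(norm (a + b))\<^sup>2 \<le> 2 * (norm a)\<^sup>2 + 2 * (norm b)\<^sup>2"
proof -
  have "(norm (a + b))\<^sup>2 \<le> (norm a + norm b)\<^sup>2"
    by (intro power_mono norm_triangle_ineq) simp
  also have "\<dots> \<le> 2 * (norm a)\<^sup>2 + 2 * (norm b)\<^sup>2"
    using zero_le_power2[of "norm a - norm b"] by (simp add: power2_eq_square algebra_simps)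
  finally show ?thesis .
qed

lemma L2_space_add:
  assumes "f \<in> L2_space M" "g \<in> L2_space M"
  shows "(\<lambda>x. f x + g x) \<in> L2_space M"
proof -
  note [measurable] = L2_spaceD(1)[OF assms(1)] L2_spaceD(1)[OF assms(2)]
  have "integrable M (\<lambda>x. (cmod (f x + g x))\<^sup>2)"
  proof (rule Bochner_Integration.integrable_bound)
    show "integrable M (\<lambda>x. 2 * (cmod (f x))\<^sup>2 + 2 * (cmod (g x))\<^sup>2)"
      using L2_spaceD(2)[OF assms(1)] L2_spaceD(2)[OF assms(2)] by simp
    show "AE x in M. norm ((cmod (f x + g x))\<^sup>2) \<le> norm (2 * (cmod (f x))\<^sup>2 + 2 * (cmod (g x))\<^sup>2)"
      by (intro AE_I2) (simp add: norm_add_sq_le)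
  qed measurable
  then show ?thesis
    by (simp add: L2_space_def)
qed

text \<open>The bound is placed on the squared modulus so that a contraction constant such as 1 -
  \<delta>^2 / K^2 can be inserted without a root.\<close>

lemma
  assumes g: "g \<in> L2_space M" and \<phi> [measurable]: "\<phi> \<in> borel_measurable M"
    and B: "\<And>x. x \<in> space M \<Longrightarrow> (cmod (\<phi> x))\<^sup>2 \<le> B"
  shows L2_space_mult_bounded: "(\<lambda>x. \<phi> x * g x) \<in> L2_space M"
    and L2_sq_mult_bounded: "L2_sq M (\<lambda>x. \<phi> x * g x) \<le> B * L2_sq M g"
proof -
  note [measurable] = L2_spaceD(1)[OF g]
  have le: "(cmod (\<phi> x * g x))\<^sup>2 \<le> B * (cmod (g x))\<^sup>2" if "x \<in> space M" for x
    using B[OF that] by (auto simp: norm_mult power_mult_distrib intro!: mult_right_mono)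
  have ig: "integrable M (\<lambda>x. B * (cmod (g x))\<^sup>2)"
    using L2_spaceD(2)[OF g] by simp
  have "norm ((cmod (\<phi> x * g x))\<^sup>2) \<le> norm (B * (cmod (g x))\<^sup>2)" if "x \<in> space M" for x
    using le[OF that] by simp
  then have i: "integrable M (\<lambda>x. (cmod (\<phi> x * g x))\<^sup>2)"
    by (intro Bochner_Integration.integrable_bound[OF ig] AE_I2) measurable
  then show "(\<lambda>x. \<phi> x * g x) \<in> L2_space M"
    by (simp add: L2_space_def)
  show "L2_sq M (\<lambda>x. \<phi> x * g x) \<le> B * L2_sq M g"
    using integral_mono[OF i ig le] by (simp add: L2_sq_def)
qed

lemma L2_space_cmult:
  assumes "g \<in> L2_space M"
  shows "(\<lambda>x. c * g x) \<in> L2_space M"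
  using L2_space_mult_bounded[OF assms, of "\<lambda>_. c"] by auto

lemma L2_sq_cmult: "L2_sq M (\<lambda>x. c * g x) = (cmod c)\<^sup>2 * L2_sq M g"
  by (simp add: L2_sq_def norm_mult power_mult_distrib)

lemma L2_space_lincomb:
  assumes "f \<in> L2_space M" "g \<in> L2_space M"
  shows "(\<lambda>x. f x + c * g x) \<in> L2_space M"
  by (intro L2_space_add L2_space_cmult assms)

lemma L2_space_diff:
  assumes "f \<in> L2_space M" "g \<in> L2_space M"
  shows "(\<lambda>x. f x - g x) \<in> L2_space M"
  using L2_space_lincomb[OF assms, of "-1"] by simp

lemma L2_sq_diff_commute: "L2_sq M (\<lambda>x. f x - g x) = L2_sq M (\<lambda>x. g x - f x)"
  by (simp add: L2_sq_def norm_minus_commute)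

lemma L2_ip_integrable:
  assumes "f \<in> L2_space M" "g \<in> L2_space M"
  shows "integrable M (\<lambda>x. f x * cnj (g x))"
proof -
  note [measurable] = L2_spaceD(1)[OF assms(1)] L2_spaceD(1)[OF assms(2)]
  have [measurable]: "cnj \<in> borel_measurable borel"
    by (intro borel_measurable_continuous_onI continuous_intros)
  show ?thesis
  proof (rule Bochner_Integration.integrable_bound)
    show "integrable M (\<lambda>x. (cmod (f x))\<^sup>2 + (cmod (g x))\<^sup>2)"
      using L2_spaceD(2)[OF assms(1)] L2_spaceD(2)[OF assms(2)] by simp
    have "a * b \<le> a\<^sup>2 + b\<^sup>2" for a b :: real
      using zero_le_power2[of "a - b"] zero_le_power2[of a] zero_le_power2[of b]
      unfolding power2_diff by linarith
    then show "AE x in M. norm (f x * cnj (g x)) \<le> norm ((cmod (f x))\<^sup>2 + (cmod (g x))\<^sup>2)"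
      by (intro AE_I2) (simp add: norm_mult)
    show "(\<lambda>x. f x * cnj (g x)) \<in> borel_measurable M"
      by measurable
  qed
qed

lemma L2_ip_lincomb_left:
  assumes "f \<in> L2_space M" "g \<in> L2_space M" "k \<in> L2_space M"
  shows "L2_ip M (\<lambda>x. f x + c * g x) k = L2_ip M f k + c * L2_ip M g k"
  using L2_ip_integrable[OF assms(1,3)] L2_ip_integrable[OF assms(2,3)]
  by (simp add: L2_ip_def distrib_right mult.assoc)

lemma L2_ip_diff_left:
  assumes "f \<in> L2_space M" "g \<in> L2_space M" "k \<in> L2_space M"
  shows "L2_ip M (\<lambda>x. f x - g x) k = L2_ip M f k - L2_ip M g k"
  using L2_ip_lincomb_left[OF assms, of "-1"] by simp

lemma L2_ip_self: "L2_ip M g g = of_real (L2_sq M g)"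
  by (simp add: L2_ip_def L2_sq_def complex_norm_square[symmetric] flip: integral_complex_of_real)

text \<open>This expansion is the common source of the parallelogram law, Cauchy-Schwarz, the
  triangle inequality, the variational step of the projection theorem and Pythagoras; they differ
  only in the choice of \<open>c\<close>.\<close>

lemma L2_sq_lincomb:
  assumes "f \<in> L2_space M" "g \<in> L2_space M"
  shows "L2_sq M (\<lambda>x. f x + c * g x) =
    L2_sq M f + 2 * Re (cnj c * L2_ip M f g) + (cmod c)\<^sup>2 * L2_sq M g"
proof -
  note i = L2_ip_integrable[OF assms] L2_spaceD(2)[OF assms(1)] L2_spaceD(2)[OF assms(2)]
  define h where "h = (\<lambda>x. Re (cnj c * (f x * cnj (g x))))"
  have "(cmod (f x + c * g x))\<^sup>2 = (cmod (f x))\<^sup>2 + 2 * h x + (cmod c)\<^sup>2 * (cmod (g x))\<^sup>2" for x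
    unfolding cmod_power2 h_def by (simp add: power2_eq_square algebra_simps)
  moreover have "integrable M h"
    using i unfolding h_def by (intro integrable_Re) auto
  moreover have "(LINT x|M. h x) = Re (cnj c * L2_ip M f g)"
    using i unfolding L2_ip_def h_def by (subst integral_Re) auto
  ultimately show ?thesis
    using i by (simp add: L2_sq_def)
qed

lemma L2_parallelogram:
  assumes "f \<in> L2_space M" "g \<in> L2_space M"
  shows "L2_sq M (\<lambda>x. f x + g x) + L2_sq M (\<lambda>x. f x - g x) = 2 * L2_sq M f + 2 * L2_sq M g"
  using L2_sq_lincomb[OF assms, of 1] L2_sq_lincomb[OF assms, of "-1"] by simp

lemma L2_Cauchy_Schwarz:
  assumes "f \<in> L2_space M" "g \<in> L2_space M"
  shows "(cmod (L2_ip M f g))\<^sup>2 \<le> L2_sq M f * L2_sq M g"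
proof -
  define I where "I = L2_ip M f g"
  define A where "A = L2_sq M f"
  define B where "B = L2_sq M g"
  have nn: "A \<ge> 0" "B \<ge> 0"
    by (simp_all add: A_def B_def)
  \<comment> \<open>With \<open>c = - t * I\<close> the cross term becomes real, leaving a real
    quadratic in \<open>t\<close>. Its minimiser \<open>1 / B\<close> gives the inequality.\<close>
  have *: "0 \<le> A - 2 * t * (cmod I)\<^sup>2 + t\<^sup>2 * (cmod I)\<^sup>2 * B" for t :: real
  proof -
    have "Re (cnj (- of_real t * I) * I) = - t * (cmod I)\<^sup>2"
      unfolding cmod_power2 by (simp add: power2_eq_square algebra_simps)
    then have "L2_sq M (\<lambda>x. f x + (- of_real t * I) * g x) = A - 2 * t * (cmod I)\<^sup>2 + t\<^sup>2 * (cmod I)\<^sup>2 * B"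
      unfolding L2_sq_lincomb[OF assms] I_def[symmetric] A_def[symmetric] B_def[symmetric]
      by (simp add: norm_mult power_mult_distrib)
    then show ?thesis
      by (metis L2_sq_nonneg)
  qed
  show ?thesis
  proof (cases "B = 0")
    case True
    have "cmod I = 0"
    proof (rule ccontr)
      assume "cmod I \<noteq> 0"
      then show False
        \<comment> \<open>For \<open>B = 0\<close> the quadratic is affine in \<open>t\<close> with
          negative slope; this \<open>t\<close> gives it the value -1.\<close>
        using *[of "(A + 1) / (2 * (cmod I)\<^sup>2)"] True nn by simp
    qed
    then show ?thesis
      by (simp add: I_def)
  next
    case False
    then have "B > 0"
      using nn by simp
    then have "0 \<le> A - (cmod I)\<^sup>2 / B"
      using *[of "1 / B"] by (simp add: power2_eq_square field_simps)
    then show ?thesis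
      using \<open>B > 0\<close> by (simp add: I_def A_def B_def field_simps)
  qed
qed

lemma L2_triangle:
  assumes "f \<in> L2_space M" "g \<in> L2_space M"
  shows "sqrt (L2_sq M (\<lambda>x. f x + g x)) \<le> sqrt (L2_sq M f) + sqrt (L2_sq M g)"
proof (rule real_le_lsqrt)
  have "Re (L2_ip M f g) \<le> cmod (L2_ip M f g)"
    by (rule complex_Re_le_cmod)
  also have "\<dots> \<le> sqrt (L2_sq M f * L2_sq M g)"
    by (rule real_le_rsqrt) (rule L2_Cauchy_Schwarz[OF assms])
  finally show "L2_sq M (\<lambda>x. f x + g x) \<le> (sqrt (L2_sq M f) + sqrt (L2_sq M g))\<^sup>2"
    using L2_sq_lincomb[OF assms, of 1] by (simp add: power2_sum real_sqrt_mult)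
qed auto

text \<open>Fatou's lemma turns a pointwise limit with uniformly bounded norms into a member of the
  space. It is the passage from pointwise convergence to norm estimates in the completeness
  proof.\<close>

lemma L2_Fatou:
  assumes u: "\<And>n. u n \<in> L2_space M" and v: "\<And>x. x \<in> space M \<Longrightarrow> (\<lambda>n. u n x) \<longlonglongrightarrow> v x"
    and e: "\<And>n. L2_sq M (u n) \<le> e"
  shows "v \<in> L2_space M" "L2_sq M v \<le> e"
proof -
  have um [measurable]: "u n \<in> borel_measurable M" for n
    using u by (rule L2_spaceD)
  have [measurable]: "v \<in> borel_measurable M"
    by (rule borel_measurable_LIMSEQ_metric[OF um v])
  have e0: "e \<ge> 0"
    using e[of 0] L2_sq_nonneg order_trans by blast
  have "(\<integral>\<^sup>+x. ennreal ((cmod (v x))\<^sup>2) \<partial>M) = (\<integral>\<^sup>+x. liminf (\<lambda>n. ennreal ((cmod (u n x))\<^sup>2)) \<partial>M)"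
    using v by (intro nn_integral_cong lim_imp_Liminf[symmetric] tendsto_ennrealI tendsto_intros) auto
  also have "\<dots> \<le> liminf (\<lambda>n. \<integral>\<^sup>+x. ennreal ((cmod (u n x))\<^sup>2) \<partial>M)"
    by (rule nn_integral_liminf) measurable
  also have "\<dots> = liminf (\<lambda>n. ennreal (L2_sq M (u n)))"
    unfolding L2_sq_def using L2_spaceD(2)[OF u] by (subst nn_integral_eq_integral) auto
  also have "\<dots> \<le> ennreal e"
    using e by (intro Liminf_le) (auto intro!: always_eventually ennreal_leI)
  finally have le: "(\<integral>\<^sup>+x. ennreal ((cmod (v x))\<^sup>2) \<partial>M) \<le> ennreal e" .
  then have i: "integrable M (\<lambda>x. (cmod (v x))\<^sup>2)"
    by (intro integrableI_bounded) (auto simp: le_less_trans)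
  then show "v \<in> L2_space M"
    by (simp add: L2_space_def)
  show "L2_sq M v \<le> e"
    using le e0 unfolding L2_sq_def by (subst (asm) nn_integral_eq_integral[OF i]) auto
qed

text \<open>A minimising sequence for the distance from \<open>g\<close> to \<open>H\<close> is
  Cauchy by the parallelogram law, and first variation at its limit gives orthogonality.
  Completeness is a hypothesis on \<open>H\<close>, so the argument works with a seminorm.\<close>

lemma L2_projection_exists:
  assumes sub: "H \<subseteq> L2_space M" and ne: "H \<noteq> {}"
    and lin: "\<And>f g c. f \<in> H \<Longrightarrow> g \<in> H \<Longrightarrow> (\<lambda>x. f x + c * g x) \<in> H"
    and complete: "\<And>s. (\<And>n. s n \<in> H) \<Longrightarrow>
        (\<And>e. e > 0 \<Longrightarrow> \<exists>N. \<forall>m\<ge>N. \<forall>n\<ge>N. L2_sq M (\<lambda>x. s m x - s n x) < e) \<Longrightarrow>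
        \<exists>l\<in>H. (\<lambda>n. L2_sq M (\<lambda>x. s n x - l x)) \<longlonglongrightarrow> 0"
    and g: "g \<in> L2_space M"
  shows "\<exists>h\<in>H. \<forall>k\<in>H. L2_ip M (\<lambda>x. g x - h x) k = 0"
proof -
  define q where "q = (\<lambda>h. L2_sq M (\<lambda>x. g x - h x))"
  define d where "d = (INF h\<in>H. q h)"
  have bdd: "bdd_below (q ` H)"
    by (rule bdd_belowI[of _ 0]) (auto simp: q_def)
  have d_le: "d \<le> q h" if "h \<in> H" for h
    unfolding d_def by (rule cINF_lower[OF bdd that])
  have d0: "d \<ge> 0"
    unfolding d_def using ne by (intro cINF_greatest) (auto simp: q_def)
  have "\<exists>h\<in>H. q h < d + 1 / Suc n" for n
    using cINF_less_iff[OF ne bdd, of "d + 1 / Suc n"] by (simp add: d_def)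
  then obtain s where s: "\<And>n. s n \<in> H" and qs: "\<And>n. q (s n) < d + 1 / Suc n"
    by metis
  have gs: "(\<lambda>x. g x - s n x) \<in> L2_space M" for n
    using sub s g by (intro L2_space_diff) auto
  have mid: "L2_sq M (\<lambda>x. s m x - s n x) \<le> 2 / Suc m + 2 / Suc n" for m n
  proof -
    define h where "h = (\<lambda>x. (1/2) * s m x + (1/2) * s n x)"
    have "(\<lambda>x. s m x + 1 * s n x) \<in> H" 
      by (intro lin s)
    \<comment> \<open>Closure of \<open>H\<close> is available only in the form f + c g, so half of
      a sum F is written as F + (-1/2) F.\<close>
    then have "(\<lambda>x. (s m x + 1 * s n x) + (-1/2) * (s m x + 1 * s n x)) \<in> H"
      by (intro lin s)
    also have "(\<lambda>x. (s m x + 1 * s n x) + (-1/2) * (s m x + 1 * s n x)) = h"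
      by (auto simp: h_def field_simps)
    finally have h: "h \<in> H" .
    have eq: "(\<lambda>x. (g x - s n x) + (g x - s m x)) = (\<lambda>x. 2 * (g x - h x))"
      by (auto simp: h_def field_simps)
    have "4 * q h + L2_sq M (\<lambda>x. s m x - s n x) = 2 * q (s n) + 2 * q (s m)"
      using L2_parallelogram[OF gs[of n] gs[of m]] unfolding eq L2_sq_cmult
      by (simp add: q_def)
    then show ?thesis
      using d_le[OF h] qs[of m] qs[of n] by simp
  qed
  have "\<exists>N. \<forall>m\<ge>N. \<forall>n\<ge>N. L2_sq M (\<lambda>x. s m x - s n x) < e" if e: "e > 0" for e
  proof -
    obtain N where N: "1 / Suc N < e / 4"
      using nat_approx_posE[of "e/4"] e by auto
    have small: "2 / Suc n < e / 2" if "n \<ge> N" for n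
    proof -
      have "1 / real (Suc n) \<le> 1 / real (Suc N)"
        using that by (intro frac_le) auto
      then show ?thesis
        using N by simp
    qed
    have "L2_sq M (\<lambda>x. s m x - s n x) < e" if "m \<ge> N" "n \<ge> N" for m n
      using mid[of m n] small[OF that(1)] small[OF that(2)] by linarith
    then show ?thesis
      by blast
  qed
  then obtain h where h: "h \<in> H" and lim: "(\<lambda>n. L2_sq M (\<lambda>x. s n x - h x)) \<longlonglongrightarrow> 0"
    using complete[of s] s by blast
  have gh: "(\<lambda>x. g x - h x) \<in> L2_space M"
    using sub h g by (intro L2_space_diff) auto
  have "sqrt (q h) \<le> sqrt (d + 0) + sqrt 0"
  proof (rule LIMSEQ_le_const)
    show "(\<lambda>n. sqrt (d + 1 / Suc n) + sqrt (L2_sq M (\<lambda>x. s n x - h x))) \<longlonglongrightarrow> sqrt (d + 0) + sqrt 0"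
      by (intro tendsto_intros lim LIMSEQ_Suc[OF lim_1_over_n])
    have "sqrt (q h) \<le> sqrt (d + 1 / Suc n) + sqrt (L2_sq M (\<lambda>x. s n x - h x))" for n
    proof -
      have "(\<lambda>x. s n x - h x) \<in> L2_space M"
        using sub h s by (intro L2_space_diff) auto
      from L2_triangle[OF gs[of n] this] have "sqrt (q h) \<le> sqrt (q (s n)) + sqrt (L2_sq M (\<lambda>x. s n x - h x))"
        by (simp add: q_def)
      also have "sqrt (q (s n)) \<le> sqrt (d + 1 / Suc n)"
        using qs[of n] by simp
      finally show ?thesis by simp
    qed
    then show "\<exists>N. \<forall>n\<ge>N. sqrt (q h) \<le> sqrt (d + 1 / Suc n) + sqrt (L2_sq M (\<lambda>x. s n x - h x))"
      by blast
  qed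
  then have qh: "q h = d"
    using d_le[OF h] d0 by simp
  have "L2_ip M (\<lambda>x. g x - h x) k = 0" if k: "k \<in> H" for k
  proof -
    define I where "I = L2_ip M (\<lambda>x. g x - h x) k"
    define K where "K = L2_sq M k"
    \<comment> \<open>Moving from \<open>h\<close> by \<open>t * I\<close> times \<open>k\<close>
      changes the squared distance by - t (2 - t K) |I|^2. The summand 1 allows \<open>K = 0\<close>
      and keeps \<open>t * K\<close> below 1.\<close>
    define t where "t = 1 / (K + 1)"
    have K0: "K \<ge> 0"
      by (simp add: K_def)
    have kL: "k \<in> L2_space M"
      using sub k by auto
    have "d \<le> q (\<lambda>x. h x + (of_real t * I) * k x)"
      by (intro d_le lin h k)
    also have "\<dots> = L2_sq M (\<lambda>x. (g x - h x) + (- of_real t * I) * k x)"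
      by (simp add: q_def algebra_simps)
    also have "\<dots> = d - 2 * t * (cmod I)\<^sup>2 + t\<^sup>2 * (cmod I)\<^sup>2 * K"
    proof -
      have "Re (cnj (- of_real t * I) * I) = - t * (cmod I)\<^sup>2"
        unfolding cmod_power2 by (simp add: power2_eq_square algebra_simps)
      then show ?thesis
        unfolding L2_sq_lincomb[OF gh kL] I_def[symmetric] K_def[symmetric] qh[symmetric] q_def
        by (simp add: norm_mult power_mult_distrib)
    qed
    finally have le: "t * (2 - t * K) * (cmod I)\<^sup>2 \<le> 0"
      by (simp add: power2_eq_square algebra_simps)
    have "t > 0" "t * K < 1"
      using K0 by (auto simp: t_def field_simps)
    then have "\<not> t * (2 - t * K) \<le> 0"
      by (simp add: mult_le_0_iff)
    then have "(cmod I)\<^sup>2 \<le> 0"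
      using le unfolding mult_le_0_iff[of "t * (2 - t * K)"] by linarith
    then show ?thesis
      by (simp add: I_def)
  qed
  then show ?thesis
    using h by blast
qed

section \<open>The area mean value property\<close>

text \<open>
  The detour through \<open>real^2\<close> makes \<open>measure_orthogonal_image\<close>, which is stated for \<open>real^'n\<close>,
  available for rotations of \<open>complex\<close>.
\<close>

lemma distr_lborel_real2_complex:
  "distr lborel borel (\<lambda>v::real^2. Complex (v$1) (v$2)) = lborel"
proof (rule lborel_eqI[symmetric])
  fix l u :: complex
  assume le: "\<And>b. b \<in> Basis \<Longrightarrow> l \<bullet> b \<le> u \<bullet> b"
  let ?T = "\<lambda>v::real^2. Complex (v$1) (v$2)"
  have meas: "?T \<in> borel_measurable borel"
    by (intro borel_measurable_continuous_onI) (auto simp: Complex_eq intro!: continuous_intros)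
  have B: "(Basis :: (real^2) set) = {axis 1 1, axis 2 1}"
    by (auto simp: Basis_vec_def) (metis exhaust_2)
  have ne: "axis 1 1 \<noteq> (axis 2 1 :: real^2)"
    by (simp add: axis_eq_axis)
  have ne': "\<i> \<noteq> 1"
    by (simp add: complex_eq_iff)
  have vim: "?T -` box l u = box (vector [Re l, Im l]) (vector [Re u, Im u])"
    by (auto simp: mem_box B inner_axis Basis_complex_def)
  show "emeasure (distr lborel borel ?T) (box l u) = ennreal (\<Prod>b\<in>Basis. (u - l) \<bullet> b)"
    using le[of 1] le[of \<i>] meas ne ne'
    by (subst emeasure_distr)
       (auto simp: vim emeasure_lborel_box_eq B inner_axis Basis_complex_def inner_diff_left)
qed auto

lemma distr_lborel_mult_unit:
  fixes w :: complex
  assumes w: "cmod w = 1"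
  shows "distr lborel borel ((*) w) = lborel"
proof (rule lborel_eqI[symmetric])
  fix l u :: complex
  assume le: "\<And>b. b \<in> Basis \<Longrightarrow> l \<bullet> b \<le> u \<bullet> b"
  define T where "T = (\<lambda>v::real^2. Complex (v$1) (v$2))"
  define S where "S = (\<lambda>z. vector [Re z, Im z] :: real^2)"
  have T_meas [measurable]: "T \<in> borel_measurable borel"
    unfolding T_def
    by (intro borel_measurable_continuous_onI) (auto simp: Complex_eq intro!: continuous_intros)
  have ST: "S (T v) = v" and TS: "T (S z) = z" for v z
    by (auto simp: S_def T_def vec_eq_iff forall_2)
  \<comment> \<open>Multiplication by the conjugate of \<open>w\<close>, the inverse rotation, in
    real coordinates: its image of the box is the preimage of the box under multiplication by
    \<open>w\<close>.\<close>
  define \<rho> where "\<rho> = (\<lambda>v. S (cnj w * T v))"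
  have "orthogonal_transformation \<rho>"
    unfolding orthogonal_transformation
  proof
    show "linear \<rho>"
      by (rule linearI) (auto simp: \<rho>_def S_def T_def vec_eq_iff forall_2 algebra_simps)
    have "norm (S z) = cmod z" for z
      by (simp add: S_def norm_vec_def L2_set_def UNIV_2 cmod_def)
    moreover have "cmod (T v) = norm v" for v
      by (simp add: T_def norm_vec_def L2_set_def UNIV_2 cmod_def)
    ultimately show "\<forall>v. norm (\<rho> v) = norm v"
      by (simp add: \<rho>_def norm_mult w)
  qed
  have cw: "cnj w * w = 1" "w * cnj w = 1"
    using w by (simp_all add: complex_norm_square[symmetric] mult.commute)
  define C where "C = T -` box l u"
  have C_eq: "C = box (S l) (S u)"
    unfolding C_def T_def S_def
    by (auto simp: mem_box_cart forall_2 mem_box Basis_complex_def)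
  have Cm: "C \<in> lmeasurable"
    unfolding C_eq by simp
  have im: "\<rho> ` C = T -` ((*) w -` box l u)"
  proof (intro equalityI subsetI)
    fix v assume "v \<in> \<rho> ` C"
    then show "v \<in> T -` ((*) w -` box l u)"
      by (auto simp: \<rho>_def TS C_def mult.assoc[symmetric] cw)
  next
    fix v assume v: "v \<in> T -` ((*) w -` box l u)"
    have "v = \<rho> (S (w * T v))"
      by (simp add: \<rho>_def TS ST mult.assoc[symmetric] cw)
    with v show "v \<in> \<rho> ` C"
      by (auto simp: C_def TS intro!: image_eqI[of _ _ "S (w * T v)"])
  qed
  have sets: "(*) w -` box l u \<in> sets borel"
    using measurable_sets_borel[of "(*) w" borel "box l u"] by simp
  have sets': "T -` ((*) w -` box l u) \<in> sets borel" 
    using measurable_sets_borel[OF T_meas sets] by simp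
  have distrT: "emeasure lborel A = emeasure lborel (T -` A)" if "A \<in> sets borel" for A
    using that by (subst distr_lborel_real2_complex[symmetric]) (simp add: emeasure_distr T_def[symmetric])
  have "emeasure (distr lborel borel ((*) w)) (box l u) = emeasure lborel (T -` ((*) w -` box l u))"
    using sets by (subst emeasure_distr) (auto simp: distrT)
  also have "\<dots> = emeasure lebesgue (\<rho> ` C)"
    using sets' by (simp add: im)
  also have "\<dots> = emeasure lebesgue C"
    using measurable_orthogonal_image[OF \<open>orthogonal_transformation \<rho>\<close> Cm]
      measure_orthogonal_image[OF \<open>orthogonal_transformation \<rho>\<close> Cm] Cm
    by (simp add: emeasure_eq_measure2)
  also have "\<dots> = emeasure lborel (box l u)"
    by (simp add: distrT C_eq[unfolded C_def] C_def)
  finally show "emeasure (distr lborel borel ((*) w)) (box l u) = ennreal (\<Prod>b\<in>Basis. (u - l) \<bullet> b)"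
    using le by (simp add: emeasure_lborel_box_eq)
qed auto

text \<open>Rotation by \<open>cis (pi / k)\<close> preserves the ball and the measure but changes
  the sign of z^k, so the integral equals its own negative.\<close>

lemma integral_ball_power_eq_0:
  assumes k: "k > 0"
  shows "(LINT z : ball 0 r | lborel. z ^ k) = (0::complex)"
proof -
  define w where "w = cis (pi / real k)"
  have w: "cmod w = 1"
    by (simp add: w_def)
  have wk: "w ^ k = -1"
    unfolding w_def Complex.DeMoivre using k by simp
  define F where "F = (\<lambda>z::complex. indicat_real (ball 0 r) z *\<^sub>R z ^ k)"
  have [measurable]: "F \<in> borel_measurable borel"
    unfolding F_def by (intro borel_measurable_scaleR borel_measurable_indicator
        borel_measurable_continuous_onI[of "\<lambda>z. z ^ k"] continuous_intros) auto
  have "integral\<^sup>L lborel F = integral\<^sup>L (distr lborel borel ((*) w)) F"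
    by (simp add: distr_lborel_mult_unit[OF w])
  also have "\<dots> = (LINT z|lborel. F (w * z))"
    by (rule integral_distr) auto
  also have "(\<lambda>z. F (w * z)) = (\<lambda>z. - F z)"
    using w by (auto simp: F_def fun_eq_iff indicator_def norm_mult power_mult_distrib wk)
  finally show ?thesis
    by (simp add: F_def set_lebesgue_integral_def)
qed

section \<open>Integration over balls and the mean value formula\<close>

lemma integrable_restrict_lborel_iff:
  fixes f :: "'a::euclidean_space \<Rightarrow> 'b::{banach, second_countable_topology}"
  assumes "S \<in> sets borel"
  shows "integrable (restrict_space lborel S) f \<longleftrightarrow> set_integrable lborel S f"
  using assms by (simp add: integrable_restrict_space set_integrable_def)

lemma integral_restrict_lborel:
  fixes f :: "'a::euclidean_space \<Rightarrow> 'b::{banach, second_countable_topology}"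
  assumes "S \<in> sets borel"
  shows "integral\<^sup>L (restrict_space lborel S) f = (LINT x : S | lborel. f x)"
  using assms by (simp add: integral_restrict_space set_lebesgue_integral_def)

lemma finite_measure_restrict_lborel_ball:
  "finite_measure (restrict_space lborel (ball (c::'a::euclidean_space) r))"
  using emeasure_lborel_ball_finite[of c r]
  by (intro finite_measureI) (auto simp: emeasure_restrict_space space_restrict_space)

lemma measure_lborel_ball_complex:
  "r \<ge> 0 \<Longrightarrow> measure lborel (ball (c::complex) r) = pi * r\<^sup>2"
  by (simp add: content_ball unit_ball_vol_2)

text \<open>The Taylor series may be integrated term by term, and every power except the constant
  one integrates to zero.\<close>

lemma holomorphic_mean_value_ball0:
  assumes g: "g holomorphic_on ball 0 R" and r: "0 < r" "r < R"
  shows "(LINT z : ball 0 r | lborel. g z) = of_real (pi * r\<^sup>2) * g 0"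
proof -
  define a where "a = (\<lambda>n. (deriv ^^ n) g 0 / fact n)"
  have ga: "(\<lambda>n. a n * w ^ n) sums g w" if "w \<in> ball 0 R" for w
    using holomorphic_power_series[OF g that] by (simp add: a_def)
  let ?M = "restrict_space lborel (ball (0::complex) r)"
  interpret finite_measure ?M
    by (rule finite_measure_restrict_lborel_ball)
  have mM: "measure ?M (space ?M) = pi * r\<^sup>2"
    using r by (simp add: measure_restrict_space space_restrict_space measure_lborel_ball_complex)
  \<comment> \<open>Convergence at the midpoint of \<open>r\<close> and \<open>R\<close>, a radius
    larger than \<open>r\<close>, gives absolute convergence at \<open>r\<close>.\<close>
  have "summable (\<lambda>n. a n * of_real ((r + R) / 2) ^ n)"
    using r by (intro sums_summable[OF ga]) (auto simp del: of_real_divide of_real_add)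
  then have "summable (\<lambda>n. norm (a n * of_real r ^ n))"
    by (rule powser_insidea) (use r in \<open>auto simp del: of_real_divide of_real_add\<close>)
  then have sm: "summable (\<lambda>n. cmod (a n) * r ^ n)"
    using r by (simp add: norm_mult norm_power)
  have meas: "(\<lambda>z. a i * z ^ i) \<in> borel_measurable ?M" for i
    by (intro measurable_restrict_space1 borel_measurable_continuous_onI continuous_intros) simp
  have bd: "cmod (a i * z ^ i) \<le> cmod (a i) * r ^ i" if "z \<in> space ?M" for i z
    using that by (auto simp: space_restrict_space norm_mult norm_power intro!: mult_left_mono power_mono)
  have int: "integrable ?M (\<lambda>z. a i * z ^ i)" for i
    by (rule integrable_const_bound[where B = "cmod (a i) * r ^ i"]) (use bd meas in auto)
  have "(\<lambda>i. LINT z|?M. a i * z ^ i) sums (LINT z|?M. (\<Sum>i. a i * z ^ i))"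
  proof (rule sums_integral)
    show "AE z in ?M. summable (\<lambda>i. norm (a i * z ^ i))"
      using bd by (intro AE_I2 summable_comparison_test'[OF sm]) auto
    show "summable (\<lambda>i. LINT z|?M. norm (a i * z ^ i))"
    proof (rule summable_comparison_test'[OF summable_mult[OF sm, of "pi * r\<^sup>2"]])
      fix i
      have "(LINT z|?M. norm (a i * z ^ i)) \<le> (LINT z|?M. cmod (a i) * r ^ i)"
        by (intro integral_mono integrable_norm int) (use bd in auto)
      also have "\<dots> = pi * r\<^sup>2 * (cmod (a i) * r ^ i)"
        using mM by simp
      finally show "norm (LINT z|?M. norm (a i * z ^ i)) \<le> pi * r\<^sup>2 * (cmod (a i) * r ^ i)"
        by (simp add: integral_nonneg_AE)
    qed
  qed (rule int)
  also have "(LINT z|?M. (\<Sum>i. a i * z ^ i)) = (LINT z|?M. g z)"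
    using r ga by (intro Bochner_Integration.integral_cong) (auto simp: sums_iff space_restrict_space)
  also have "(\<lambda>i. LINT z|?M. a i * z ^ i) = (\<lambda>i. if i = 0 then a 0 * of_real (pi * r\<^sup>2) else 0)"
  proof
    fix i
    show "(LINT z|?M. a i * z ^ i) = (if i = 0 then a 0 * of_real (pi * r\<^sup>2) else 0)"
    proof (cases "i = 0")
      case True
      then show ?thesis
        using mM by (simp add: scaleR_conv_of_real mult.commute)
    next
      case False
      then show ?thesis
        by (simp add: integral_restrict_lborel integral_ball_power_eq_0)
    qed
  qed
  finally have "(\<lambda>i. if i = 0 then a 0 * of_real (pi * r\<^sup>2) else 0) sums (LINT z|?M. g z)" .
  moreover have "(\<lambda>i. if i = 0 then a 0 * of_real (pi * r\<^sup>2) else 0) sums (a 0 * of_real (pi * r\<^sup>2))"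
    using sums_single[of 0 "\<lambda>_. a 0 * of_real (pi * r\<^sup>2)"] by simp
  ultimately have "(LINT z|?M. g z) = a 0 * of_real (pi * r\<^sup>2)"
    using sums_unique2 by blast
  then show ?thesis
    by (simp add: a_def integral_restrict_lborel mult.commute)
qed

text \<open>After translation to the origin, the mean value formula for the square of f bounds |f
  z|^2 directly by the integral of |f|^2. Point evaluations are thus continuous, which lets norm
  convergence force locally uniform convergence.\<close>

lemma holomorphic_pointwise_L2_bound:
  assumes f: "f holomorphic_on S" and S: "open S" "ball z R \<subseteq> S" and r: "0 < r" "r < R"
    and int: "set_integrable lborel S (\<lambda>w. (cmod (f w))\<^sup>2)"
  shows "pi * r\<^sup>2 * (cmod (f z))\<^sup>2 \<le> (LINT w : S | lborel. (cmod (f w))\<^sup>2)"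
proof -
  have sub: "ball z r \<subseteq> S"
    using S r by (meson less_imp_le order_trans subset_ball)
  define g where "g = (\<lambda>w. (f (z + w))\<^sup>2)"
  have g: "g holomorphic_on ball 0 R"
    unfolding g_def
  proof (intro holomorphic_intros)
    show "(\<lambda>w. f (z + w)) holomorphic_on ball 0 R"
    proof (rule holomorphic_on_compose_gen[of "\<lambda>w. z + w" "ball 0 R" f S, unfolded o_def])
      show "(\<lambda>w. z + w) holomorphic_on ball 0 R"
        by (intro holomorphic_intros)
      show "(\<lambda>w. z + w) ` ball 0 R \<subseteq> S"
        using S(2) by (auto simp: subset_eq dist_norm)
    qed (rule f)
  qed
  have "pi * r\<^sup>2 * (cmod (f z))\<^sup>2 = cmod (LINT w : ball 0 r | lborel. g w)"
    unfolding holomorphic_mean_value_ball0[OF g r] by (simp add: g_def norm_mult norm_power)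
  also have "\<dots> \<le> (LINT w|lborel. norm (indicat_real (ball 0 r) w *\<^sub>R g w))"
    unfolding set_lebesgue_integral_def by (rule integral_norm_bound)
  also have "(\<lambda>w. norm (indicat_real (ball 0 r) w *\<^sub>R g w)) =
      (\<lambda>w. indicat_real (ball z r) (z + w) *\<^sub>R (cmod (f (z + w)))\<^sup>2)"
    by (auto simp: fun_eq_iff indicator_def g_def norm_power dist_norm)
  also have "(LINT w|lborel. indicat_real (ball z r) (z + w) *\<^sub>R (cmod (f (z + w)))\<^sup>2) =
      (LINT w|distr lborel borel ((+) z). indicat_real (ball z r) w *\<^sub>R (cmod (f w))\<^sup>2)"
  proof (rule integral_distr[symmetric])
    have "set_integrable lborel (ball z r) (\<lambda>w. (cmod (f w))\<^sup>2)"
      using set_integrable_subset[OF int _ sub] by simp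
    then show "(\<lambda>w. indicat_real (ball z r) w *\<^sub>R (cmod (f w))\<^sup>2) \<in> borel_measurable borel"
      unfolding set_integrable_def by (auto dest: borel_measurable_integrable)
  qed auto
  also have "\<dots> = (LINT w : ball z r | lborel. (cmod (f w))\<^sup>2)"
    by (simp add: lborel_distr_plus set_lebesgue_integral_def)
  also have "\<dots> \<le> (LINT w : S | lborel. (cmod (f w))\<^sup>2)"
    unfolding set_lebesgue_integral_def
    by (intro integral_mono int[unfolded set_integrable_def]
        set_integrable_subset[OF int _ sub, unfolded set_integrable_def])
      (use sub in \<open>auto simp: indicator_def\<close>)
  finally show ?thesis .
qed

section \<open>The Bergman space and its projection\<close>

abbreviation disc_measure :: "complex measure" where
  "disc_measure \<equiv> restrict_space lborel disc"

lemma L2_inner_eq: "L2_inner g k = L2_ip disc_measure g k / of_real pi"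
  by (simp add: L2_inner_def L2_ip_def integral_restrict_lborel)

lemma L2_norm_disc_eq: "L2_norm_disc f = sqrt (L2_sq disc_measure f) / sqrt pi"
  by (simp add: L2_norm_disc_def L2_sq_def integral_restrict_lborel real_sqrt_divide)

lemma continuous_on_disc_measurable:
  "continuous_on disc f \<Longrightarrow> f \<in> borel_measurable disc_measure"
  using borel_measurable_continuous_on_restrict[of disc f]
  by (subst measurable_cong_sets[OF sets_restrict_space_cong[OF sets_lborel] refl])

lemma Bergman_iff:
  "f \<in> Bergman \<longleftrightarrow> f holomorphic_on disc \<and> (\<forall>z. z \<notin> disc \<longrightarrow> f z = 0) \<and> f \<in> L2_space disc_measure"
  by (auto simp: Bergman_def L2_space_def integrable_restrict_lborel_iff
      intro!: continuous_on_disc_measurable holomorphic_on_imp_continuous_on)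

lemma BergmanD:
  assumes "f \<in> Bergman"
  shows "f holomorphic_on disc" "z \<notin> disc \<Longrightarrow> f z = 0" "f \<in> L2_space disc_measure"
  using assms by (auto simp: Bergman_iff)

lemma Bergman_0: "(\<lambda>_. 0) \<in> Bergman"
  by (simp add: Bergman_def set_integrable_def)

lemma Bergman_lincomb:
  assumes "f \<in> Bergman" "g \<in> Bergman"
  shows "(\<lambda>z. f z + c * g z) \<in> Bergman"
  using assms by (auto simp: Bergman_iff intro!: holomorphic_intros L2_space_lincomb)

lemma Bergman_diff:
  assumes "f \<in> Bergman" "g \<in> Bergman"
  shows "(\<lambda>z. f z - g z) \<in> Bergman"
  using Bergman_lincomb[OF assms, of "-1"] by simp

lemma Bergman_add:
  assumes "f \<in> Bergman" "g \<in> Bergman"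
  shows "(\<lambda>z. f z + g z) \<in> Bergman"
  using Bergman_lincomb[OF assms, of 1] by simp

lemma Bergman_cmult:
  assumes "f \<in> Bergman"
  shows "(\<lambda>z. c * f z) \<in> Bergman"
  using Bergman_lincomb[OF Bergman_0 assms, of c] by simp

text \<open>The radius \<open>d / 2\<close> is one convenient choice strictly below
  \<open>d\<close>; the applications use only that the constant is positive.\<close>

lemma Bergman_pointwise_bound:
  assumes f: "f \<in> Bergman" and d: "d > 0" "ball z d \<subseteq> disc"
  shows "pi * (d / 2)\<^sup>2 * (cmod (f z))\<^sup>2 \<le> L2_sq disc_measure f"
proof -
  have "set_integrable lborel disc (\<lambda>w. (cmod (f w))\<^sup>2)"
    using f by (simp add: Bergman_def)
  then show ?thesis
    using holomorphic_pointwise_L2_bound[OF BergmanD(1)[OF f] _ d(2), of "d / 2"] d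
    by (simp add: L2_sq_def integral_restrict_lborel)
qed

text \<open>The pointwise bound kills f inside the disc and the normalisation kills it outside. This
  makes the projection unique as a function and \<open>Bergman_dist\<close> a genuine
  metric.\<close>

lemma Bergman_L2_sq_eq_0_iff:
  assumes f: "f \<in> Bergman"
  shows "L2_sq disc_measure f = 0 \<longleftrightarrow> f = (\<lambda>_. 0)"
proof
  assume 0: "L2_sq disc_measure f = 0"
  show "f = (\<lambda>_. 0)"
  proof
    fix z
    show "f z = 0"
    proof (cases "z \<in> disc")
      case True
      then obtain d where "d > 0" "ball z d \<subseteq> disc"
        using open_contains_ball open_ball by blast
      then show ?thesis
        using Bergman_pointwise_bound[OF f, of d z] 0 pi_gt_zero by (simp add: mult_le_0_iff)
    qed (use f BergmanD in auto)
  qed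
qed (simp add: L2_sq_def)

text \<open>By the pointwise bound a norm-Cauchy sequence is uniformly Cauchy on small closed discs,
  so its pointwise limit is holomorphic; Fatou's lemma then shows that this limit is also the norm
  limit.\<close>

lemma Bergman_complete:
  assumes s: "\<And>n. s n \<in> Bergman"
    and Cauchy: "\<And>e. e > 0 \<Longrightarrow> \<exists>N. \<forall>m\<ge>N. \<forall>n\<ge>N. L2_sq disc_measure (\<lambda>z. s m z - s n z) < e"
  shows "\<exists>l\<in>Bergman. (\<lambda>n. L2_sq disc_measure (\<lambda>z. s n z - l z)) \<longlonglongrightarrow> 0"
proof -
  define g where "g = (\<lambda>z. lim (\<lambda>n. s n z))"
  have ul: "\<exists>d>0. cball z d \<subseteq> disc \<and> uniform_limit (cball z d) s g sequentially" if z: "z \<in> disc" for z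
  proof -
    \<comment> \<open>Half the distance to the unit circle, so that a ball of radius
      \<open>d\<close> around any point of \<open>cball z d\<close> still lies in the disc.\<close>
    define d where "d = (1 - cmod z) / 2"
    have d: "d > 0"
      using z by (simp add: d_def)
    have near: "ball x d \<subseteq> disc" if "x \<in> cball z d" for x
    proof
      fix y assume "y \<in> ball x d"
      then have "cmod (y - x) < d" "cmod (x - z) \<le> d"
        using that by (auto simp: dist_norm norm_minus_commute)
      then have "cmod ((y - x) + (x - z) + z) < d + d + cmod z"
        by (smt (verit) norm_triangle_ineq)
      then show "y \<in> disc"
        by (simp add: d_def)
    qed
    have "uniformly_Cauchy_on (cball z d) s"
      unfolding uniformly_Cauchy_on_def
    proof (intro allI impI)
      fix e :: real assume e: "e > 0"
      have "pi * (d / 2)\<^sup>2 * e\<^sup>2 > 0"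
        using d e by simp
      then obtain N where N: "\<And>m n. m \<ge> N \<Longrightarrow> n \<ge> N \<Longrightarrow>
          L2_sq disc_measure (\<lambda>z. s m z - s n z) < pi * (d / 2)\<^sup>2 * e\<^sup>2"
        using Cauchy by blast
      have "dist (s m x) (s n x) < e" if "x \<in> cball z d" "m \<ge> N" "n \<ge> N" for x m n
      proof -
        have "pi * (d / 2)\<^sup>2 * (cmod (s m x - s n x))\<^sup>2 < pi * (d / 2)\<^sup>2 * e\<^sup>2"
          using Bergman_pointwise_bound[OF Bergman_diff[OF s s] d near[OF that(1)], of m n] N[OF that(2,3)]
          by linarith
        then have "(cmod (s m x - s n x))\<^sup>2 < e\<^sup>2"
          using d by (simp add: mult_less_cancel_left)
        then show ?thesis
          using e by (simp add: dist_norm power_less_imp_less_base)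
      qed
      then show "\<exists>M. \<forall>x\<in>cball z d. \<forall>m\<ge>M. \<forall>n\<ge>M. dist (s m x) (s n x) < e"
        by blast
    qed
    then have "uniform_limit (cball z d) s g sequentially"
      unfolding g_def by (simp add: Cauchy_uniformly_convergent flip: uniformly_convergent_uniform_limit_iff)
    moreover have "cball z d \<subseteq> disc"
      using near d by (meson centre_in_ball subsetD subsetI)
    ultimately show ?thesis
      using d by blast
  qed
  have g: "g holomorphic_on disc"
    by (rule holomorphic_uniform_sequence[OF _ BergmanD(1)[OF s] ul]) auto
  define l where "l = (\<lambda>z. if z \<in> disc then g z else 0)"
  have l: "l holomorphic_on disc"
    by (rule holomorphic_transform[OF g]) (simp add: l_def)
  have lim: "(\<lambda>n. s n z) \<longlonglongrightarrow> l z" if z: "z \<in> space disc_measure" for z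
  proof -
    have z: "z \<in> disc"
      using z by (simp add: space_restrict_space)
    obtain d where d: "d > 0" "uniform_limit (cball z d) s g sequentially"
      using ul[OF z] by blast
    show ?thesis
      using z d(1) tendsto_uniform_limitI[OF d(2), of z] by (simp add: l_def)
  qed
  \<comment> \<open>Fatou's lemma is applied in the second index with \<open>n\<close> fixed; the
    shift by \<open>N\<close> makes the bound hold for every term.\<close>
  have fatou: "(\<lambda>z. s n z - l z) \<in> L2_space disc_measure \<and> L2_sq disc_measure (\<lambda>z. s n z - l z) \<le> e"
    if N: "\<forall>m\<ge>N. L2_sq disc_measure (\<lambda>z. s n z - s m z) < e" for n N e
  proof -
    have u: "(\<lambda>z. s n z - s (m + N) z) \<in> L2_space disc_measure" for m
      by (intro L2_space_diff BergmanD(3) s)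
    have v: "(\<lambda>m. s n z - s (m + N) z) \<longlonglongrightarrow> s n z - l z" if "z \<in> space disc_measure" for z
      by (intro tendsto_intros LIMSEQ_ignore_initial_segment lim that)
    have "L2_sq disc_measure (\<lambda>z. s n z - s (m + N) z) \<le> e" for m
      using N by (auto intro: less_imp_le)
    then show ?thesis
      using L2_Fatou[of "\<lambda>m z. s n z - s (m + N) z" disc_measure "\<lambda>z. s n z - l z", OF u v] by blast
  qed
  have "l \<in> Bergman"
  proof -
    obtain N where N: "\<forall>m\<ge>N. L2_sq disc_measure (\<lambda>z. s N z - s m z) < 1"
      using Cauchy[of 1] by auto
    \<comment> \<open>The limit is recovered as a difference of two square integrable functions, the
      second of which comes from \<open>fatou\<close>.\<close>
    have "(\<lambda>z. s N z - (s N z - l z)) \<in> L2_space disc_measure"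
      by (rule L2_space_diff[OF BergmanD(3)[OF s] conjunct1[OF fatou[OF N]]])
    then show ?thesis
      using l by (simp add: Bergman_iff l_def)
  qed
  moreover have "(\<lambda>n. L2_sq disc_measure (\<lambda>z. s n z - l z)) \<longlonglongrightarrow> 0"
  proof (rule LIMSEQ_I)
    fix r :: real assume "r > 0"
    then obtain N where "\<And>m n. m \<ge> N \<Longrightarrow> n \<ge> N \<Longrightarrow> L2_sq disc_measure (\<lambda>z. s n z - s m z) < r / 2"
      using Cauchy[of "r / 2"] by auto
    then have "L2_sq disc_measure (\<lambda>z. s n z - l z) \<le> r / 2" if "n \<ge> N" for n
      using that by (intro conjunct2[OF fatou[of N]]) auto
    then show "\<exists>N. \<forall>n\<ge>N. norm (L2_sq disc_measure (\<lambda>z. s n z - l z) - 0) < r"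
      using \<open>r > 0\<close> by (intro exI[of _ N]) fastforce
  qed
  ultimately show ?thesis
    by blast
qed

section \<open>Existence, uniqueness and basic properties of the projection\<close>

lemma bergman_proj_exists:
  assumes "g \<in> L2_space disc_measure"
  shows "\<exists>h\<in>Bergman. \<forall>k\<in>Bergman. L2_inner (\<lambda>z. g z - h z) k = 0"
  unfolding L2_inner_eq
proof -
  have "\<exists>h\<in>Bergman. \<forall>k\<in>Bergman. L2_ip disc_measure (\<lambda>z. g z - h z) k = 0"
  proof (rule L2_projection_exists[OF _ _ Bergman_lincomb Bergman_complete assms])
    show "Bergman \<subseteq> L2_space disc_measure"
      using BergmanD(3) by blast
    show "Bergman \<noteq> {}"
      using Bergman_0 by blast
  qed
  then show "\<exists>h\<in>Bergman. \<forall>k\<in>Bergman. L2_ip disc_measure (\<lambda>z. g z - h z) k / of_real pi = 0"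
    by simp
qed

text \<open>The difference of two candidates lies in \<open>Bergman\<close> and is orthogonal to
  itself.\<close>

lemma bergman_proj_unique:
  assumes g: "g \<in> L2_space disc_measure"
    and h: "h \<in> Bergman" "\<And>k. k \<in> Bergman \<Longrightarrow> L2_inner (\<lambda>z. g z - h z) k = 0"
    and h': "h' \<in> Bergman" "\<And>k. k \<in> Bergman \<Longrightarrow> L2_inner (\<lambda>z. g z - h' z) k = 0"
  shows "h = h'"
proof -
  let ?k = "\<lambda>z. h z - h' z"
  note L2 = BergmanD(3)[OF h(1)] BergmanD(3)[OF h'(1)] BergmanD(3)[OF Bergman_diff[OF h(1) h'(1)]]
  have "L2_ip disc_measure (\<lambda>z. g z - h z) ?k = 0" "L2_ip disc_measure (\<lambda>z. g z - h' z) ?k = 0"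
    using h(2) h'(2) Bergman_diff[OF h(1) h'(1)] by (auto simp: L2_inner_eq)
  then have "L2_ip disc_measure ?k ?k = 0"
    using g L2 by (simp add: L2_ip_diff_left)
  then have "?k = (\<lambda>_. 0)"
    using Bergman_L2_sq_eq_0_iff[OF Bergman_diff[OF h(1) h'(1)]] by (simp add: L2_ip_self)
  then show ?thesis
    by (simp add: fun_eq_iff)
qed

lemma bergman_proj_eqI:
  assumes "g \<in> L2_space disc_measure"
    and "h \<in> Bergman" "\<And>k. k \<in> Bergman \<Longrightarrow> L2_inner (\<lambda>z. g z - h z) k = 0"
  shows "bergman_proj g = h"
  unfolding bergman_proj_def
  by (rule the_equality) (use assms bergman_proj_unique in blast)+

lemma
  assumes g: "g \<in> L2_space disc_measure"
  shows bergman_proj_in: "bergman_proj g \<in> Bergman"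
    and bergman_proj_orth: "k \<in> Bergman \<Longrightarrow> L2_ip disc_measure (\<lambda>z. g z - bergman_proj g z) k = 0"
proof -
  obtain h where h: "h \<in> Bergman" "\<And>k. k \<in> Bergman \<Longrightarrow> L2_inner (\<lambda>z. g z - h z) k = 0"
    using bergman_proj_exists[OF g] by blast
  have eq: "bergman_proj g = h"
    using g h by (rule bergman_proj_eqI)
  show "bergman_proj g \<in> Bergman"
    using h eq by simp
  show "L2_ip disc_measure (\<lambda>z. g z - bergman_proj g z) k = 0" if "k \<in> Bergman"
    using h(2)[OF that] by (simp add: L2_inner_eq eq)
qed

lemma bergman_proj_id:
  assumes "f \<in> Bergman"
  shows "bergman_proj f = f"
  by (rule bergman_proj_eqI) (use assms in \<open>auto dest: BergmanD simp: L2_inner_eq L2_ip_def\<close>)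

lemma bergman_proj_lincomb:
  assumes f: "f \<in> L2_space disc_measure" and g: "g \<in> L2_space disc_measure"
  shows "bergman_proj (\<lambda>z. f z + c * g z) = (\<lambda>z. bergman_proj f z + c * bergman_proj g z)"
proof (rule bergman_proj_eqI)
  fix k assume k: "k \<in> Bergman"
  have eq: "(\<lambda>z. f z + c * g z - (bergman_proj f z + c * bergman_proj g z)) =
      (\<lambda>z. (f z - bergman_proj f z) + c * (g z - bergman_proj g z))"
    by (auto simp: algebra_simps)
  have L: "(\<lambda>z. h z - bergman_proj h z) \<in> L2_space disc_measure" if "h \<in> L2_space disc_measure" for h
    by (rule L2_space_diff[OF that BergmanD(3)[OF bergman_proj_in[OF that]]])
  show "L2_inner (\<lambda>z. f z + c * g z - (bergman_proj f z + c * bergman_proj g z)) k = 0"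
    unfolding eq L2_inner_eq L2_ip_lincomb_left[OF L[OF f] L[OF g] BergmanD(3)[OF k]]
    using bergman_proj_orth[OF f k] bergman_proj_orth[OF g k] by simp
qed (use f g in \<open>auto intro!: L2_space_lincomb Bergman_lincomb bergman_proj_in\<close>)

text \<open>Pythagoras: \<open>g\<close> is the sum of its projection and an orthogonal
  remainder.\<close>

lemma bergman_proj_L2_le:
  assumes g: "g \<in> L2_space disc_measure"
  shows "L2_sq disc_measure (bergman_proj g) \<le> L2_sq disc_measure g"
proof -
  let ?h = "bergman_proj g"
  note hB = bergman_proj_in[OF g]
  note hL = BergmanD(3)[OF hB]
  have "L2_sq disc_measure (\<lambda>z. (g z - ?h z) + 1 * ?h z) =
      L2_sq disc_measure (\<lambda>z. g z - ?h z) + L2_sq disc_measure ?h"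
    unfolding L2_sq_lincomb[OF L2_space_diff[OF g hL] hL] bergman_proj_orth[OF g hB] by simp
  then show ?thesis
    using L2_sq_nonneg[of disc_measure "\<lambda>z. g z - ?h z"] by simp
qed

section \<open>Toeplitz operators\<close>

text \<open>The last estimate compares with the product itself rather than with a supremum bound:
  the peaking argument needs the smallness of \<phi> near a single point.\<close>

lemma
  assumes \<phi>: "continuous_on disc \<phi>" "\<And>z. z \<in> disc \<Longrightarrow> (cmod (\<phi> z))\<^sup>2 \<le> B" and f: "f \<in> Bergman"
  shows symbol_mult_L2: "(\<lambda>z. \<phi> z * f z) \<in> L2_space disc_measure"
    and symbol_mult_L2_le: "L2_sq disc_measure (\<lambda>z. \<phi> z * f z) \<le> B * L2_sq disc_measure f"
    and toeplitz_in: "toeplitz \<phi> f \<in> Bergman"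
    and toeplitz_L2_le_mult: "L2_sq disc_measure (toeplitz \<phi> f) \<le> L2_sq disc_measure (\<lambda>z. \<phi> z * f z)"
proof -
  have bd: "(cmod (\<phi> z))\<^sup>2 \<le> B" if "z \<in> space disc_measure" for z
    using that \<phi>(2) by (simp add: space_restrict_space)
  note m = continuous_on_disc_measurable[OF \<phi>(1)]
  show L2: "(\<lambda>z. \<phi> z * f z) \<in> L2_space disc_measure"
    using L2_space_mult_bounded[OF BergmanD(3)[OF f] m bd] .
  show "L2_sq disc_measure (\<lambda>z. \<phi> z * f z) \<le> B * L2_sq disc_measure f"
    using L2_sq_mult_bounded[OF BergmanD(3)[OF f] m bd] .
  show "toeplitz \<phi> f \<in> Bergman"
    unfolding toeplitz_def by (rule bergman_proj_in[OF L2])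
  show "L2_sq disc_measure (toeplitz \<phi> f) \<le> L2_sq disc_measure (\<lambda>z. \<phi> z * f z)"
    unfolding toeplitz_def by (rule bergman_proj_L2_le[OF L2])
qed

lemma toeplitz_lincomb:
  assumes \<phi>: "continuous_on disc \<phi>" "\<And>z. z \<in> disc \<Longrightarrow> (cmod (\<phi> z))\<^sup>2 \<le> B"
    and f: "f \<in> Bergman" and g: "g \<in> Bergman"
  shows "toeplitz \<phi> (\<lambda>z. f z + c * g z) = (\<lambda>z. toeplitz \<phi> f z + c * toeplitz \<phi> g z)"
proof -
  have "(\<lambda>z. \<phi> z * (f z + c * g z)) = (\<lambda>z. \<phi> z * f z + c * (\<phi> z * g z))"
    by (simp add: fun_eq_iff algebra_simps)
  then show ?thesis
    unfolding toeplitz_def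
    using bergman_proj_lincomb[OF symbol_mult_L2[OF \<phi> f] symbol_mult_L2[OF \<phi> g], of c] by simp
qed

text \<open>The operator is linear in its symbol, and the symbol 1 acts as the identity because the
  projection fixes \<open>Bergman\<close>.\<close>

lemma toeplitz_one_plus:
  assumes \<phi>: "continuous_on disc \<phi>" "\<And>z. z \<in> disc \<Longrightarrow> (cmod (\<phi> z))\<^sup>2 \<le> B" and f: "f \<in> Bergman"
  shows "toeplitz (\<lambda>z. 1 + c * \<phi> z) f = (\<lambda>z. f z + c * toeplitz \<phi> f z)"
proof -
  have "(\<lambda>z. (1 + c * \<phi> z) * f z) = (\<lambda>z. f z + c * (\<phi> z * f z))"
    by (simp add: fun_eq_iff algebra_simps)
  then show ?thesis
    unfolding toeplitz_def
    using bergman_proj_lincomb[OF BergmanD(3)[OF f] symbol_mult_L2[OF \<phi> f], of c] bergman_proj_id[OF f]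
    by simp
qed

section \<open>The Bergman space as a complete metric space\<close>

definition Bergman_dist :: "(complex \<Rightarrow> complex) \<Rightarrow> (complex \<Rightarrow> complex) \<Rightarrow> real" where
  "Bergman_dist f g = sqrt (L2_sq disc_measure (\<lambda>z. f z - g z))"

text \<open>This makes the Banach fixed point theorem for metric spaces with a carrier set
  applicable.\<close>

interpretation Bergman: Metric_space Bergman Bergman_dist
proof
  fix f g :: "complex \<Rightarrow> complex"
  show "0 \<le> Bergman_dist f g" "Bergman_dist f g = Bergman_dist g f"
    by (simp_all add: Bergman_dist_def L2_sq_diff_commute[of _ f g])
  assume fg: "f \<in> Bergman" "g \<in> Bergman"
  show "Bergman_dist f g = 0 \<longleftrightarrow> f = g"
    using Bergman_L2_sq_eq_0_iff[OF Bergman_diff[OF fg]] by (auto simp: Bergman_dist_def fun_eq_iff)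
  fix h assume h: "h \<in> Bergman"
  show "Bergman_dist f h \<le> Bergman_dist f g + Bergman_dist g h"
    using L2_triangle[OF BergmanD(3)[OF Bergman_diff[OF fg]] BergmanD(3)[OF Bergman_diff[OF fg(2) h]]]
    by (simp add: Bergman_dist_def)
qed

lemma Bergman_mcomplete: "Bergman.mcomplete"
  unfolding Bergman.mcomplete_def
proof (intro allI impI)
  fix s assume s: "Bergman.MCauchy s"
  then have sB: "s n \<in> Bergman" for n
    by (auto simp: Bergman.MCauchy_def)
  have cauchy: "\<exists>N. \<forall>m\<ge>N. \<forall>n\<ge>N. L2_sq disc_measure (\<lambda>z. s m z - s n z) < e" if e: "e > 0" for e
  proof -
    have "sqrt e > 0"
      using e by simp
    then obtain N where "\<forall>m n. N \<le> m \<longrightarrow> N \<le> n \<longrightarrow> Bergman_dist (s m) (s n) < sqrt e"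
      using s unfolding Bergman.MCauchy_def by blast
    then show ?thesis
      by (auto simp: Bergman_dist_def)
  qed
  obtain l where l: "l \<in> Bergman" "(\<lambda>n. L2_sq disc_measure (\<lambda>z. s n z - l z)) \<longlonglongrightarrow> 0"
    using Bergman_complete[of s, OF sB cauchy] by blast
  have "(\<lambda>n. Bergman_dist (s n) l) \<longlonglongrightarrow> 0"
    using tendsto_real_sqrt[OF l(2)] by (simp add: Bergman_dist_def)
  then have "\<exists>N. \<forall>n\<ge>N. Bergman_dist (s n) l < e" if "e > 0" for e
    using LIMSEQ_D[of "\<lambda>n. Bergman_dist (s n) l" 0 e] that by fastforce
  then show "\<exists>l. limitin Bergman.mtopology s l sequentially"
    using l(1) sB by (auto simp: Bergman.limit_metric_sequentially)
qed

text \<open>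
  For small \<open>\<epsilon> > 0\<close> the symbol \<open>1 - \<epsilon> \<phi>\<close> has supremum norm below 1, so the equation
  \<open>T\<^sub>\<phi> g = f\<close> becomes the fixed point equation of the contraction \<open>g \<mapsto> \<epsilon> f + T g\<close>
  with \<open>T\<close> the Toeplitz operator of \<open>1 - \<epsilon> \<phi>\<close>.
\<close>

lemma toeplitz_invertible:
  assumes \<phi>: "continuous_on disc \<phi>" and K: "\<And>z. z \<in> disc \<Longrightarrow> cmod (\<phi> z) \<le> K"
    and \<delta>: "\<delta> > 0" "\<And>z. z \<in> disc \<Longrightarrow> \<delta> \<le> Re (\<phi> z)"
  shows "invertible_on_Bergman (toeplitz \<phi>)"
proof -
  let ?T = "toeplitz \<phi>"
  define n where "n = (\<lambda>f. sqrt (L2_sq disc_measure f))"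
  have "\<delta> \<le> K"
    using K[of 0] \<delta>(2)[of 0] complex_Re_le_cmod[of "\<phi> 0"] by simp
  then have K0: "K > 0"
    using \<delta>(1) by simp
  \<comment> \<open>This value minimises 1 - 2 \<epsilon> \<delta> + \<epsilon>^2 K^2, the bound for
    the squared modulus of \<open>\<psi>\<close>; the minimum is the constant
    \<open>B\<close>.\<close>
  define \<epsilon> where "\<epsilon> = \<delta> / K\<^sup>2"
  have \<epsilon>: "\<epsilon> > 0"
    using \<delta>(1) K0 by (simp add: \<epsilon>_def)
  define B where "B = 1 - \<delta>\<^sup>2 / K\<^sup>2"
  have B: "0 \<le> B" "B < 1"
    using \<delta>(1) K0 power_mono[OF \<open>\<delta> \<le> K\<close>, of 2] by (auto simp: B_def divide_le_eq)
  have K2: "(cmod (\<phi> z))\<^sup>2 \<le> K\<^sup>2" if "z \<in> disc" for z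
    using K[OF that] by (intro power_mono) auto
  define \<psi> where "\<psi> = (\<lambda>z. 1 + (- of_real \<epsilon>) * \<phi> z)"
  have \<psi>c: "continuous_on disc \<psi>"
    unfolding \<psi>_def by (intro continuous_intros \<phi>)
  have \<psi>B: "(cmod (\<psi> z))\<^sup>2 \<le> B" if z: "z \<in> disc" for z
  proof -
    have "(cmod (\<psi> z))\<^sup>2 = 1 - 2 * \<epsilon> * Re (\<phi> z) + \<epsilon>\<^sup>2 * (cmod (\<phi> z))\<^sup>2"
      unfolding cmod_power2 \<psi>_def by (simp add: power2_eq_square algebra_simps)
    also have "\<dots> \<le> 1 - 2 * \<epsilon> * \<delta> + \<epsilon>\<^sup>2 * K\<^sup>2"
      using \<delta>(2)[OF z] K2[OF z] \<epsilon> by (intro add_mono diff_mono mult_left_mono) auto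
    also have "\<dots> = B"
      using K0 by (simp add: B_def \<epsilon>_def power2_eq_square field_simps)
    finally show ?thesis .
  qed
  have T_in: "?T f \<in> Bergman" if "f \<in> Bergman" for f
    using toeplitz_in[OF \<phi> K2 that] .
  have \<psi>_in: "toeplitz \<psi> f \<in> Bergman" if "f \<in> Bergman" for f
    using toeplitz_in[OF \<psi>c \<psi>B that] .
  have T\<psi>: "toeplitz \<psi> f = (\<lambda>z. f z - of_real \<epsilon> * ?T f z)" if "f \<in> Bergman" for f
    using toeplitz_one_plus[OF \<phi> K2 that, of "- of_real \<epsilon>"] by (simp add: \<psi>_def)
  have \<psi>_le: "n (toeplitz \<psi> f) \<le> sqrt B * n f" if "f \<in> Bergman" for f
    using toeplitz_L2_le_mult[OF \<psi>c \<psi>B that] symbol_mult_L2_le[OF \<psi>c \<psi>B that]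
    by (auto simp: n_def real_sqrt_mult[symmetric])
  have surj: "\<exists>g\<in>Bergman. ?T g = f" if f: "f \<in> Bergman" for f
  proof -
    define F where "F = (\<lambda>g z. of_real \<epsilon> * f z + toeplitz \<psi> g z)"
    obtain g where g: "g \<in> Bergman" "F g = g"
    proof (rule Bergman.Banach_fixedpoint_thm[OF Bergman_mcomplete, of F "sqrt B"])
      show "Bergman \<noteq> {}"
        using f by blast
      show "F \<in> Bergman \<rightarrow> Bergman"
        using f \<psi>_in by (auto simp: F_def intro!: Bergman_add Bergman_cmult)
      show "sqrt B < 1"
        using B by simp
      fix g h assume gh: "g \<in> Bergman" "h \<in> Bergman"
      have "toeplitz \<psi> (\<lambda>z. g z - h z) = (\<lambda>z. toeplitz \<psi> g z - toeplitz \<psi> h z)"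
        using toeplitz_lincomb[OF \<psi>c \<psi>B gh, of "-1"] by simp
      then have "Bergman_dist (F g) (F h) = n (toeplitz \<psi> (\<lambda>z. g z - h z))"
        by (simp add: Bergman_dist_def F_def n_def)
      also have "\<dots> \<le> sqrt B * Bergman_dist g h"
        using \<psi>_le[OF Bergman_diff[OF gh]] by (simp add: Bergman_dist_def n_def)
      finally show "Bergman_dist (F g) (F h) \<le> sqrt B * Bergman_dist g h" .
    qed
    have "?T g z = f z" for z
      using fun_cong[OF g(2), of z] T\<psi>[OF g(1)] \<epsilon> by (simp add: F_def algebra_simps)
    then show ?thesis
      using g(1) by blast
  qed
  \<comment> \<open>Writing f as \<epsilon> \<open>?T f\<close> plus
    \<open>toeplitz \<psi> f\<close> and absorbing the second term gives this constant. The estimate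
    yields injectivity as well as the bound for the inverse.\<close>
  define C where "C = \<epsilon> / (1 - sqrt B)"
  have below: "n f \<le> C * n (?T f)" if f: "f \<in> Bergman" for f
  proof -
    have "f = (\<lambda>z. of_real \<epsilon> * ?T f z + toeplitz \<psi> f z)"
      using T\<psi>[OF f] by simp
    then have "n f = n (\<lambda>z. of_real \<epsilon> * ?T f z + toeplitz \<psi> f z)"
      by (rule arg_cong)
    also have "\<dots> \<le> n (\<lambda>z. of_real \<epsilon> * ?T f z) + n (toeplitz \<psi> f)"
      unfolding n_def by (intro L2_triangle L2_space_cmult BergmanD(3) T_in \<psi>_in f)
    also have "n (\<lambda>z. of_real \<epsilon> * ?T f z) = \<epsilon> * n (?T f)"
      using \<epsilon> by (simp add: n_def L2_sq_cmult real_sqrt_mult)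
    also have "n (toeplitz \<psi> f) \<le> sqrt B * n f"
      by (rule \<psi>_le[OF f])
    finally have "(1 - sqrt B) * n f \<le> \<epsilon> * n (?T f)"
      by (simp add: algebra_simps)
    moreover have "1 - sqrt B > 0"
      using B by simp
    ultimately show ?thesis
      by (simp add: C_def field_simps)
  qed
  have inj: "g = h" if gh: "g \<in> Bergman" "h \<in> Bergman" "?T g = ?T h" for g h
  proof -
    have "?T (\<lambda>z. g z - h z) = (\<lambda>z. 0)"
      using toeplitz_lincomb[OF \<phi> K2 gh(1,2), of "-1"] gh(3) by simp
    then have "Bergman_dist g h \<le> 0"
      using below[OF Bergman_diff[OF gh(1,2)]] by (simp add: n_def Bergman_dist_def L2_sq_def)
    then show ?thesis
      using Bergman.zero[OF gh(1,2)] Bergman.nonneg[of g h] by linarith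
  qed
  define S where "S = (\<lambda>f. SOME g. g \<in> Bergman \<and> ?T g = f)"
  have S: "S f \<in> Bergman \<and> ?T (S f) = f" if "f \<in> Bergman" for f
    using someI_ex[of "\<lambda>g. g \<in> Bergman \<and> ?T g = f"] surj[OF that] unfolding S_def by blast
  have ST: "S (?T f) = f" if "f \<in> Bergman" for f
    using S[OF T_in[OF that]] inj that by blast
  have "L2_norm_disc (S f) \<le> C * L2_norm_disc f" if "f \<in> Bergman" for f
    using below[of "S f"] S[OF that] by (simp add: L2_norm_disc_eq n_def divide_right_mono)
  then show ?thesis
    unfolding invertible_on_Bergman_def using T_in S ST by blast
qed

text \<open>
  The function \<open>h z = (1 + cnj \<zeta> * z) / 2\<close> peaks at \<open>\<zeta>\<close>, so the powers of \<open>h\<close> concentrate their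
  mass where \<open>\<phi>\<close> is small.
\<close>

lemma toeplitz_not_invertible:
  assumes \<phi>: "continuous_on (cball 0 1) \<phi>" and \<zeta>: "cmod \<zeta> = 1" "\<phi> \<zeta> = 0"
  shows "\<not> invertible_on_Bergman (toeplitz \<phi>)"
proof
  assume "invertible_on_Bergman (toeplitz \<phi>)"
  then obtain S C where S: "\<And>f. f \<in> Bergman \<Longrightarrow> S (toeplitz \<phi> f) = f"
    and T: "\<And>f. f \<in> Bergman \<Longrightarrow> toeplitz \<phi> f \<in> Bergman"
    and C: "\<And>f. f \<in> Bergman \<Longrightarrow> L2_norm_disc (S f) \<le> C * L2_norm_disc f"
    unfolding invertible_on_Bergman_def by blast
  let ?M = disc_measure
  interpret finite_measure ?M
    by (rule finite_measure_restrict_lborel_ball)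
  have "bounded (\<phi> ` cball 0 1)"
    by (intro compact_imp_bounded compact_continuous_image \<phi> compact_cball)
  then obtain K where "\<forall>w\<in>\<phi> ` cball 0 1. cmod w \<le> K"
    unfolding bounded_iff by blast
  then have K: "cmod (\<phi> z) \<le> K" if "z \<in> cball 0 1" for z
    using that by blast
  have \<phi>d: "continuous_on disc \<phi>"
    using \<phi> by (rule continuous_on_subset) auto
  have K2: "(cmod (\<phi> z))\<^sup>2 \<le> K\<^sup>2" if "z \<in> disc" for z
    using K[of z] that by (intro power_mono) auto
  \<comment> \<open>Squaring gives a nonnegative factor whatever the sign of
    \<open>C\<close>.\<close>
  have below: "L2_sq ?M f \<le> C\<^sup>2 * L2_sq ?M (\<lambda>z. \<phi> z * f z)" if f: "f \<in> Bergman" for f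
  proof -
    have "sqrt (L2_sq ?M f) \<le> C * sqrt (L2_sq ?M (toeplitz \<phi> f))"
      using C[OF T[OF f]] S[OF f] by (simp add: L2_norm_disc_eq divide_le_cancel)
    then have "(sqrt (L2_sq ?M f))\<^sup>2 \<le> (C * sqrt (L2_sq ?M (toeplitz \<phi> f)))\<^sup>2"
      by (intro power_mono) auto
    then have "L2_sq ?M f \<le> C\<^sup>2 * L2_sq ?M (toeplitz \<phi> f)"
      by (simp add: power_mult_distrib)
    also have "\<dots> \<le> C\<^sup>2 * L2_sq ?M (\<lambda>z. \<phi> z * f z)"
      using toeplitz_L2_le_mult[OF \<phi>d K2 f] by (intro mult_left_mono) auto
    finally show ?thesis .
  qed
  define h where "h = (\<lambda>z. (1 + cnj \<zeta> * z) / 2)"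
  have h_cont: "continuous_on UNIV h"
    unfolding h_def by (intro continuous_intros) auto
  have \<zeta>\<zeta>: "cnj \<zeta> * \<zeta> = 1" "\<zeta> * cnj \<zeta> = 1"
    using \<zeta>(1) by (simp_all add: complex_norm_square[symmetric] mult.commute)
  have h_le: "cmod (h z) \<le> 1" if "cmod z \<le> 1" for z
    using norm_triangle_ineq[of 1 "cnj \<zeta> * z"] that \<zeta>(1) by (simp add: h_def norm_mult norm_divide)
  \<comment> \<open>If |w| is at most 1, then |1 + w| reaches 2 only at w = 1: the expansion of the
    square forces Re w = 1 and Im w = 0.\<close>
  have h_eq: "z = \<zeta>" if "cmod z \<le> 1" "cmod (h z) \<ge> 1" for z
  proof -
    define w where "w = cnj \<zeta> * z"
    have w: "cmod w \<le> 1"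
      using that \<zeta> by (simp add: w_def norm_mult)
    have "(cmod (1 + w))\<^sup>2 \<ge> 2\<^sup>2"
      using that(2) by (intro power_mono) (auto simp: h_def w_def norm_divide)
    moreover have "(cmod (1 + w))\<^sup>2 = 1 + 2 * Re w + (cmod w)\<^sup>2"
      unfolding cmod_power2 by (simp add: power2_eq_square algebra_simps)
    moreover have "(cmod w)\<^sup>2 \<le> 1"
      using w by (simp add: power_le_one)
    ultimately have "Re w \<ge> 1"
      by simp
    moreover have "(Re w)\<^sup>2 + (Im w)\<^sup>2 \<le> 1"
      using \<open>(cmod w)\<^sup>2 \<le> 1\<close> by (simp add: cmod_power2)
    moreover have "(Re w)\<^sup>2 \<ge> Re w"
      using \<open>Re w \<ge> 1\<close> by (simp add: power2_eq_square)
    ultimately have "Re w = 1" "(Im w)\<^sup>2 \<le> 0"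
      using zero_le_power2[of "Im w"] by linarith+
    then have "w = 1"
      by (simp add: complex_eq_iff)
    have "z = \<zeta> * w"
      by (simp add: w_def mult.assoc[symmetric] \<zeta>\<zeta>)
    then show "z = \<zeta>"
      using \<open>w = 1\<close> by simp
  qed
  \<comment> \<open>Chosen so that the part of the integral where \<phi> is small contributes at
    most half of the norm of f, which can be absorbed. The summand 1 covers
    \<open>C = 0\<close>.\<close>
  define \<epsilon> where "\<epsilon> = 1 / (2 * (C\<^sup>2 + 1))"
  have \<epsilon>: "\<epsilon> > 0" "C\<^sup>2 * \<epsilon> \<le> 1 / 2"
    using add_nonneg_pos[OF zero_le_power2[of C] zero_less_one] by (simp_all add: \<epsilon>_def divide_le_eq)
  define E where "E = {z \<in> cball 0 1. (cmod (\<phi> z))\<^sup>2 \<ge> \<epsilon>}"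
  have E: "compact E"
  proof -
    have "continuous_on (cball 0 1) (\<lambda>z. (cmod (\<phi> z))\<^sup>2)"
      by (intro continuous_intros \<phi>)
    then have "closed (cball 0 1 \<inter> (\<lambda>z. (cmod (\<phi> z))\<^sup>2) -` {\<epsilon>..})"
      by (rule continuous_closed_preimage) auto
    then have "compact (cball 0 1 \<inter> (cball 0 1 \<inter> (\<lambda>z. (cmod (\<phi> z))\<^sup>2) -` {\<epsilon>..}))"
      by (rule compact_Int_closed[OF compact_cball])
    also have "cball 0 1 \<inter> (cball 0 1 \<inter> (\<lambda>z. (cmod (\<phi> z))\<^sup>2) -` {\<epsilon>..}) = E"
      by (auto simp: E_def)
    finally show ?thesis .
  qed
  \<comment> \<open>The compact set \<open>E\<close> avoids the peak point \<zeta>, so |h| stays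
    away from 1 on it. The value 1/2 serves for empty \<open>E\<close> and otherwise keeps \<rho>
    positive.\<close>
  obtain \<rho> where \<rho>: "\<rho> < 1" "\<rho> > 0" "\<And>z. z \<in> E \<Longrightarrow> cmod (h z) \<le> \<rho>"
  proof (cases "E = {}")
    case True
    then show ?thesis
      using that[of "1/2"] by auto
  next
    case False
    have "continuous_on E (\<lambda>z. cmod (h z))"
      by (intro continuous_intros continuous_on_subset[OF h_cont]) auto
    then obtain x where x: "x \<in> E" "\<And>z. z \<in> E \<Longrightarrow> cmod (h z) \<le> cmod (h x)"
      using continuous_attains_sup[OF E False] by blast
    have "x \<noteq> \<zeta>"
      using x(1) \<zeta>(2) \<epsilon>(1) by (auto simp: E_def)
    then have "cmod (h x) < 1"
      using h_eq[of x] x(1) by (force simp: E_def)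
    then show ?thesis
      using that[of "max (1/2) (cmod (h x))"] x(2) by (auto simp: le_max_iff_disj)
  qed
  \<comment> \<open>A level strictly between \<rho> and 1: the k-th power of h has squared modulus
    at least \<sigma>^(2k) on \<open>U\<close> but at most \<rho>^(2k) on \<open>E\<close> inside
    the disc.\<close>
  define \<sigma> where "\<sigma> = (\<rho> + 1) / 2"
  have \<sigma>: "\<rho> < \<sigma>" "\<sigma> < 1" "\<sigma> > 0"
    using \<rho> by (auto simp: \<sigma>_def)
  define U where "U = {z \<in> disc. cmod (h z) > \<sigma>}"
  have "U = disc \<inter> {z. \<sigma> < cmod (h z)}"
    by (auto simp: U_def)
  moreover have "open {z. \<sigma> < cmod (h z)}"
    by (intro open_Collect_less continuous_intros h_cont)
  ultimately have "open U"
    by auto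
  then have U_sets: "U \<in> sets ?M"
    by (auto simp: sets_restrict_space_iff U_def)
  \<comment> \<open>On the radius towards \<zeta> the function h is real, and its value (1 +
    \<sigma>) / 2 exceeds \<sigma>; thus the open set \<open>U\<close> is nonempty and has positive
    measure.\<close>
  have "of_real \<sigma> * \<zeta> \<in> U"
  proof -
    have "h (of_real \<sigma> * \<zeta>) = of_real ((1 + \<sigma>) / 2)"
      using \<zeta>\<zeta> by (simp add: h_def mult.left_commute[of "cnj \<zeta>"])
    then have "cmod (h (of_real \<sigma> * \<zeta>)) = (1 + \<sigma>) / 2"
      using \<sigma> by (simp only: norm_of_real) simp
    then show ?thesis
      using \<sigma> \<zeta> by (simp add: U_def norm_mult)
  qed
  then obtain x e where e: "e > 0" "ball x e \<subseteq> U"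
    using \<open>open U\<close> open_contains_ball by blast
  have mU: "measure ?M U > 0"
  proof -
    have "ball x e \<subseteq> disc"
      using e(2) by (auto simp: U_def)
    then have "measure ?M (ball x e) = pi * e\<^sup>2"
      using e(1) by (simp add: measure_restrict_space measure_lborel_ball_complex)
    moreover have "measure ?M (ball x e) \<le> measure ?M U"
      by (rule finite_measure_mono[OF e(2) U_sets])
    moreover have "pi * e\<^sup>2 > 0"
      using e(1) by simp
    ultimately show ?thesis
      by linarith
  qed
  define f where "f = (\<lambda>k z. if z \<in> disc then h z ^ k else 0)"
  have f_le: "(cmod (f k z))\<^sup>2 \<le> 1" for k z
    using h_le[of z] by (auto simp: f_def norm_power intro!: power_le_one)
  have fB: "f k \<in> Bergman" for k
  proof -
    have "(\<lambda>z. h z ^ k) holomorphic_on disc"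
      unfolding h_def by (intro holomorphic_intros) auto
    then have hol: "f k holomorphic_on disc"
      by (rule holomorphic_transform) (simp add: f_def)
    then have [measurable]: "f k \<in> borel_measurable ?M"
      by (intro continuous_on_disc_measurable holomorphic_on_imp_continuous_on)
    have "integrable ?M (\<lambda>z. (cmod (f k z))\<^sup>2)"
      by (rule integrable_const_bound[where B = 1]) (use f_le in auto)
    then have "f k \<in> L2_space ?M"
      by (simp add: L2_space_def)
    moreover have "\<forall>z. z \<notin> disc \<longrightarrow> f k z = 0"
      by (simp add: f_def)
    ultimately show ?thesis
      using hol by (simp add: Bergman_iff)
  qed
  have f_int: "integrable ?M (\<lambda>z. (cmod (f k z))\<^sup>2)" for k
    using L2_spaceD(2)[OF BergmanD(3)[OF fB]] .
  have f_sq: "(cmod (f k z))\<^sup>2 = cmod (h z) ^ (2 * k)" if "z \<in> disc" for k z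
    using that by (simp add: f_def norm_power power_even_eq)
  have lower: "\<sigma> ^ (2 * k) * measure ?M U \<le> L2_sq ?M (f k)" for k
  proof -
    have "\<sigma> ^ (2 * k) * measure ?M U = (LINT z|?M. \<sigma> ^ (2 * k) * indicat_real U z)"
      using U_sets sets.sets_into_space[OF U_sets] by (simp add: Int_absorb2)
    also have "\<dots> \<le> L2_sq ?M (f k)"
      unfolding L2_sq_def
    proof (rule integral_mono[OF _ f_int])
      show "integrable ?M (\<lambda>z. \<sigma> ^ (2 * k) * indicat_real U z)"
        using U_sets by (intro integrable_mult_right integrable_real_indicator) (auto simp: emeasure_eq_measure)
      show "\<sigma> ^ (2 * k) * indicat_real U z \<le> (cmod (f k z))\<^sup>2" for z
      proof (cases "z \<in> U")
        case True
        then have "\<sigma> ^ (2 * k) \<le> cmod (h z) ^ (2 * k)"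
          using \<sigma> by (intro power_mono) (auto simp: U_def)
        then show ?thesis
          using True f_sq[of z k] by (simp add: U_def)
      qed simp
    qed
    finally show ?thesis .
  qed
  have upper: "L2_sq ?M (\<lambda>z. \<phi> z * f k z) \<le> \<epsilon> * L2_sq ?M (f k) + K\<^sup>2 * \<rho> ^ (2 * k) * pi" for k
  proof -
    have mM: "measure ?M (space ?M) = pi"
      by (simp add: measure_restrict_space space_restrict_space measure_lborel_ball_complex)
    have "L2_sq ?M (\<lambda>z. \<phi> z * f k z) \<le> (LINT z|?M. \<epsilon> * (cmod (f k z))\<^sup>2 + K\<^sup>2 * \<rho> ^ (2 * k))"
      unfolding L2_sq_def
    proof (rule integral_mono[OF L2_spaceD(2)[OF symbol_mult_L2[OF \<phi>d K2 fB]]])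
      show "integrable ?M (\<lambda>z. \<epsilon> * (cmod (f k z))\<^sup>2 + K\<^sup>2 * \<rho> ^ (2 * k))"
        using f_int by simp
      fix z assume "z \<in> space ?M"
      then have z: "z \<in> disc"
        by (simp add: space_restrict_space)
      have eq: "(cmod (\<phi> z * f k z))\<^sup>2 = (cmod (\<phi> z))\<^sup>2 * (cmod (f k z))\<^sup>2"
        by (simp add: norm_mult power_mult_distrib)
      show "(cmod (\<phi> z * f k z))\<^sup>2 \<le> \<epsilon> * (cmod (f k z))\<^sup>2 + K\<^sup>2 * \<rho> ^ (2 * k)"
      proof (cases "z \<in> E")
        case True
        have "(cmod (f k z))\<^sup>2 = cmod (h z) ^ (2 * k)"
          by (rule f_sq[OF z])
        also have "\<dots> \<le> \<rho> ^ (2 * k)"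
          by (intro power_mono \<rho>(3) True) auto
        finally have "(cmod (\<phi> z))\<^sup>2 * (cmod (f k z))\<^sup>2 \<le> K\<^sup>2 * \<rho> ^ (2 * k)"
          using K2[OF z] by (intro mult_mono) auto
        then show ?thesis
          using \<epsilon>(1) unfolding eq by (simp add: add_increasing)
      next
        case False
        then have "(cmod (\<phi> z))\<^sup>2 * (cmod (f k z))\<^sup>2 \<le> \<epsilon> * (cmod (f k z))\<^sup>2"
          using z by (intro mult_right_mono) (auto simp: E_def)
        moreover have "0 \<le> K\<^sup>2 * \<rho> ^ (2 * k)"
          using \<rho>(2) by simp
        ultimately show ?thesis
          unfolding eq by linarith
      qed
    qed
    also have "\<dots> = \<epsilon> * L2_sq ?M (f k) + K\<^sup>2 * \<rho> ^ (2 * k) * pi"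
      using f_int[of k] mM by (simp add: L2_sq_def)
    finally show ?thesis .
  qed
  \<comment> \<open>Half of \<open>L\<close> is absorbed by the choice of \<epsilon>; the lower and
    upper estimates then bound a fixed positive measure by a null sequence.\<close>
  have main: "measure ?M U \<le> 2 * C\<^sup>2 * K\<^sup>2 * pi * ((\<rho> / \<sigma>)\<^sup>2) ^ k" for k
  proof -
    define L where "L = L2_sq ?M (f k)"
    have "L \<le> C\<^sup>2 * (\<epsilon> * L + K\<^sup>2 * \<rho> ^ (2 * k) * pi)"
      unfolding L_def using below[OF fB[of k]] mult_left_mono[OF upper[of k], of "C\<^sup>2"] by simp
    moreover have "(C\<^sup>2 * \<epsilon>) * L \<le> 1 / 2 * L"
      using \<epsilon>(2) by (intro mult_right_mono) (auto simp: L_def)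
    ultimately have "L \<le> 2 * C\<^sup>2 * K\<^sup>2 * pi * \<rho> ^ (2 * k)"
      by (simp add: algebra_simps)
    then have "\<sigma> ^ (2 * k) * measure ?M U \<le> 2 * C\<^sup>2 * K\<^sup>2 * pi * \<rho> ^ (2 * k)"
      using lower[of k] by (simp add: L_def)
    then have "measure ?M U \<le> 2 * C\<^sup>2 * K\<^sup>2 * pi * \<rho> ^ (2 * k) / \<sigma> ^ (2 * k)"
      using \<sigma>(3) by (simp add: pos_le_divide_eq mult.commute)
    also have "\<dots> = 2 * C\<^sup>2 * K\<^sup>2 * pi * ((\<rho> / \<sigma>)\<^sup>2) ^ k"
      by (simp add: power_divide power_mult)
    finally show ?thesis .
  qed
  have "(\<lambda>k. 2 * C\<^sup>2 * K\<^sup>2 * pi * ((\<rho> / \<sigma>)\<^sup>2) ^ k) \<longlonglongrightarrow> 2 * C\<^sup>2 * K\<^sup>2 * pi * 0"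
    using \<rho> \<sigma> by (intro tendsto_intros LIMSEQ_power_zero) (auto simp: power_less_one_iff abs_square_less_1)
  then have "measure ?M U \<le> 2 * C\<^sup>2 * K\<^sup>2 * pi * 0"
    by (rule LIMSEQ_le_const) (use main in blast)
  with mU show False
    by simp
qed

section \<open>Trigonometric symbols\<close>

lemma cos_eq_minus1_int:
  "cos x = -1 \<longleftrightarrow> (\<exists>k::int. x = pi + 2 * pi * of_int k)"
proof -
  have "cos (x - pi) = - cos x"
    by (simp add: cos_diff)
  then have "cos x = -1 \<longleftrightarrow> cos (x - pi) = 1"
    by auto
  also have "\<dots> \<longleftrightarrow> (\<exists>k::int. x - pi = of_int k * 2 * pi)"
    by (rule cos_one_2pi_int)
  also have "\<dots> \<longleftrightarrow> (\<exists>k::int. x = pi + 2 * pi * of_int k)"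
    by (intro ex_cong1) (auto simp: algebra_simps)
  finally show ?thesis .
qed

lemma mult_cis_polar: "a * cis \<theta> = of_real (cmod a) * cis (\<theta> + Arg a)"
proof -
  have "a = of_real (cmod a) * cis (Arg a)"
    using rcis_cmod_Arg[of a] by (simp add: rcis_def)
  then have "a * cis \<theta> = of_real (cmod a) * cis (Arg a) * cis \<theta>"
    by simp
  then show ?thesis
    by (simp add: mult.assoc cis_mult add.commute)
qed

lemma Re_mult_cis_eq_minus_cmod_iff:
  assumes "a \<noteq> 0"
  shows "Re (a * cis \<theta>) = - cmod a \<longleftrightarrow> (\<exists>k::int. \<theta> + Arg a = pi + 2 * pi * of_int k)"
proof -
  have "Re (a * cis \<theta>) = - cmod a \<longleftrightarrow> cmod a * cos (\<theta> + Arg a) = cmod a * (-1)"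
    by (subst mult_cis_polar) simp
  also have "\<dots> \<longleftrightarrow> cos (\<theta> + Arg a) = -1"
    unfolding mult_cancel_left using assms by simp
  finally show ?thesis
    by (simp add: cos_eq_minus1_int)
qed

text \<open>A cosine equal to -1 forces the sine to vanish, so the whole term is known and not only
  its real part. This is what makes P itself vanish at the boundary point.\<close>

lemma mult_cis_eq_minus_cmod:
  assumes "\<theta> + Arg a = pi + 2 * pi * of_int k"
  shows "a * cis \<theta> = - of_real (cmod a)"
proof -
  have "cos (\<theta> + Arg a) = -1"
    using assms cos_eq_minus1_int by blast
  moreover from this have "sin (\<theta> + Arg a) = 0"
    using sin_cos_squared_add[of "\<theta> + Arg a"] by simp
  ultimately show ?thesis
    by (subst mult_cis_polar) (simp add: complex_eq_iff)
qed

lemma Re_mult_ge_minus_cmod: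
  assumes "cmod w \<le> 1"
  shows "- cmod a \<le> Re (a * w)"
proof -
  have "\<bar>Re (a * w)\<bar> \<le> cmod a * cmod w"
    using abs_Re_le_cmod[of "a * w"] by (simp add: norm_mult)
  also have "\<dots> \<le> cmod a * 1"
    by (intro mult_left_mono assms) auto
  finally show ?thesis
    by simp
qed

text \<open>\<open>Arg\<close> fixes one choice of the argument; any other choice differs by a
  multiple of 2 pi and only changes the integers \<open>k\<close> and \<open>l\<close>.\<close>

theorem theorem3p3:
  fixes p0 :: real and M N :: "nat set" and p q :: "nat \<Rightarrow> complex"
  assumes "p0 \<ge> 1"
    and "finite M" and "finite N" and "0 \<notin> M" and "0 \<notin> N"
    and "\<forall>m\<in>M. p m \<noteq> 0" and "\<forall>n\<in>N. q n \<noteq> 0"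
    and "(\<Sum>m\<in>M. cmod (p m)) + (\<Sum>n\<in>N. cmod (q n)) = 1"
  defines "P \<equiv> (\<lambda>z. complex_of_real p0 + (\<Sum>m\<in>M. p m * z ^ m) + (\<Sum>n\<in>N. q n * cnj z ^ n))"
  shows "(p0 > 1 \<longrightarrow> invertible_on_Bergman (toeplitz P))
       \<and> (p0 = 1 \<longrightarrow>
            (\<not> invertible_on_Bergman (toeplitz P) \<longleftrightarrow>
             (\<exists>t\<in>{0..2*pi}.
                (\<forall>m\<in>M. \<exists>k::int. real m * t + Arg (p m) = pi + 2 * pi * of_int k)
              \<and> (\<forall>n\<in>N. \<exists>l::int. - real n * t + Arg (q n) = pi + 2 * pi * of_int l))))"
proof -
  have cont: "continuous_on S P" for S
    unfolding P_def by (intro continuous_intros)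
  have "bounded (P ` cball 0 1)"
    by (intro compact_imp_bounded compact_continuous_image cont compact_cball)
  then obtain K where "\<forall>w\<in>P ` cball 0 1. cmod w \<le> K"
    unfolding bounded_iff by blast
  then have K: "cmod (P z) \<le> K" if "z \<in> disc" for z
    using that by (simp add: image_iff)
  have inv: "invertible_on_Bergman (toeplitz P)" if "\<delta> > 0" "\<And>z. z \<in> disc \<Longrightarrow> \<delta> \<le> Re (P z)" for \<delta>
    using toeplitz_invertible[OF cont K that] .
  \<comment> \<open>\<open>A\<close> and \<open>B\<close> measure how far the real part of each term
    lies above its least possible value. As the moduli sum to 1, Re P is \<open>p0 - 1\<close> plus
    these nonnegative gaps.\<close>
  define A where "A = (\<lambda>z m. cmod (p m) + Re (p m * z ^ m))"
  define B where "B = (\<lambda>z n. cmod (q n) + Re (q n * cnj z ^ n))"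
  have A0: "A z m \<ge> 0" and B0: "B z m \<ge> 0" if "cmod z \<le> 1" for z m
    using that Re_mult_ge_minus_cmod[of "z ^ m" "p m"] Re_mult_ge_minus_cmod[of "cnj z ^ m" "q m"]
    by (auto simp: A_def B_def norm_power power_le_one)
  have ReP: "Re (P z) = p0 - 1 + (\<Sum>m\<in>M. A z m) + (\<Sum>n\<in>N. B z n)" for z
    using assms(8) by (simp add: P_def A_def B_def sum.distrib)
  have part1: "invertible_on_Bergman (toeplitz P)" if "p0 > 1"
  proof (rule inv[of "p0 - 1"])
    fix z :: complex assume "z \<in> disc"
    then have "(\<Sum>m\<in>M. A z m) \<ge> 0" "(\<Sum>n\<in>N. B z n) \<ge> 0"
      by (auto intro!: sum_nonneg A0 B0)
    then show "p0 - 1 \<le> Re (P z)"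
      unfolding ReP by linarith
  qed (use that in simp)
  define Q where "Q = (\<lambda>t. (\<forall>m\<in>M. \<exists>k::int. real m * t + Arg (p m) = pi + 2 * pi * of_int k)
              \<and> (\<forall>n\<in>N. \<exists>l::int. - real n * t + Arg (q n) = pi + 2 * pi * of_int l))"
  have pow: "cis t ^ k = cis (real k * t)" "cnj (cis t) ^ k = cis (- real k * t)" for t k
    by (simp_all only: Complex.DeMoivre cis_cnj) simp
  have not_inv: "\<not> invertible_on_Bergman (toeplitz P)" if p0: "p0 = 1" and Q: "Q t" for t
  proof (rule toeplitz_not_invertible[OF cont])
    have "p m * cis t ^ m = - of_real (cmod (p m))" if "m \<in> M" for m
      using Q that mult_cis_eq_minus_cmod unfolding Q_def pow by blast
    moreover have "q n * cnj (cis t) ^ n = - of_real (cmod (q n))" if "n \<in> N" for n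
      using Q that mult_cis_eq_minus_cmod unfolding Q_def pow by blast
    ultimately have "P (cis t) = 1 - of_real ((\<Sum>m\<in>M. cmod (p m)) + (\<Sum>n\<in>N. cmod (q n)))"
      by (simp add: P_def p0 sum_negf)
    then show "P (cis t) = 0"
      unfolding assms(8) by simp
  qed simp
  have pos: "\<exists>t\<in>{0..2*pi}. Q t" if p0: "p0 = 1" and z: "cmod z \<le> 1" and le: "Re (P z) \<le> 0" for z
  proof -
    have "(\<Sum>m\<in>M. A z m) \<ge> 0" "(\<Sum>n\<in>N. B z n) \<ge> 0"
      using z by (auto intro!: sum_nonneg A0 B0)
    then have "(\<Sum>m\<in>M. A z m) = 0" "(\<Sum>n\<in>N. B z n) = 0"
      using le ReP[of z] p0 by linarith+
    then have A: "\<And>m. m \<in> M \<Longrightarrow> A z m = 0" and B: "\<And>n. n \<in> N \<Longrightarrow> B z n = 0"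
      using A0[OF z] B0[OF z] assms(2,3) by (auto simp: sum_nonneg_eq_0_iff)
    \<comment> \<open>Inside the disc a positive power of |z| is below 1, which leaves the gap of a
      nonzero coefficient strictly positive.\<close>
    have unit: "cmod z = 1" if "a \<noteq> 0" "k > 0" "cmod a + Re (a * w) = 0" "cmod w = cmod z ^ k" for a w k
    proof (rule ccontr)
      assume "cmod z \<noteq> 1"
      then have "cmod z ^ k < 1"
        using z that(2) by (simp add: power_less_one_iff)
      have "cmod a = - Re (a * w)"
        using that(3) by simp
      also have "\<dots> \<le> cmod a * cmod z ^ k"
        using abs_Re_le_cmod[of "a * w"] that(4) by (simp add: norm_mult)
      also have "\<dots> < cmod a * 1"
        using \<open>cmod z ^ k < 1\<close> that(1) by (intro mult_strict_left_mono) auto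
      finally show False
        by simp
    qed
    \<comment> \<open>At least one term is needed to force z onto the circle; the normalisation of
      the coefficients supplies it.\<close>
    have "M \<noteq> {} \<or> N \<noteq> {}"
      using assms(8) by auto
    then have "cmod z = 1"
    proof
      assume "M \<noteq> {}"
      then obtain m where "m \<in> M"
        by blast
      then show ?thesis
        using A[of m] assms(4,6) by (intro unit[of "p m" m "z ^ m"]) (auto simp: A_def norm_power intro!: gr0I)
    next
      assume "N \<noteq> {}"
      then obtain n where "n \<in> N"
        by blast
      then show ?thesis
        using B[of n] assms(5,7) by (intro unit[of "q n" n "cnj z ^ n"]) (auto simp: B_def norm_power intro!: gr0I)
    qed
    then have z_eq: "z = cis (Arg2pi z)"
      using Arg2pi_eq[of z] by (simp add: cis_conv_exp mult.commute)
    define t where "t = Arg2pi z"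
    have "Q t"
      unfolding Q_def
    proof (intro conjI ballI)
      fix m assume m: "m \<in> M"
      have "Re (p m * cis (real m * t)) = - cmod (p m)"
        using A[OF m] unfolding A_def pow[symmetric] t_def z_eq[symmetric] by simp
      then show "\<exists>k::int. real m * t + Arg (p m) = pi + 2 * pi * of_int k"
        using Re_mult_cis_eq_minus_cmod_iff assms(6) m by blast
    next
      fix n assume n: "n \<in> N"
      have "Re (q n * cis (- real n * t)) = - cmod (q n)"
        using B[OF n] unfolding B_def pow[symmetric] t_def z_eq[symmetric] by simp
      then show "\<exists>l::int. - real n * t + Arg (q n) = pi + 2 * pi * of_int l"
        using Re_mult_cis_eq_minus_cmod_iff assms(7) n by blast
    qed
    moreover have "t \<in> {0..2*pi}"
      using Arg2pi[of z] by (simp add: t_def)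
    ultimately show ?thesis
      by blast
  qed
  have part2: "invertible_on_Bergman (toeplitz P)" if p0: "p0 = 1" and nQ: "\<not> (\<exists>t\<in>{0..2*pi}. Q t)"
  proof -
    have "continuous_on (cball 0 1) (\<lambda>z. Re (P z))"
      by (intro continuous_intros cont)
    then obtain z0 where z0: "z0 \<in> cball 0 1" "\<And>z. z \<in> cball 0 1 \<Longrightarrow> Re (P z0) \<le> Re (P z)"
      using continuous_attains_inf[OF compact_cball, of 0 1 "\<lambda>z. Re (P z)"] by auto
    \<comment> \<open>Otherwise \<open>pos\<close> at the minimum point would produce an angle
      satisfying \<open>Q\<close>. The minimum itself serves as the lower bound in
      \<open>inv\<close>.\<close>
    have "Re (P z0) > 0"
      using pos[OF p0, of z0] z0(1) nQ by force
    then show ?thesis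
      by (rule inv) (use z0(2) in simp)
  qed
  show ?thesis
    unfolding Q_def[symmetric] using part1 part2 not_inv by blast
qed

end
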